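(* Let $M$ be a 2-concave Orlicz function. Then the Orlicz sequence space $l^M$ is isomorphic to a subspace of $L^1$; that is, there exist a linear map $T:l^M\to L^1$ and a constant $C\geq 1$ such that $C^{-1}\|x\|_M\le\|Tx\|_{L^1}\le C\|x\|_M$ for all $x\in l^M$.
   Context: An Orlicz function is a convex function $M:\mathbb{R}\to\mathbb{R}$ with $M(t)=M(-t)$, $M(0)=0$, and $M(t)>0$ for $t\ne0$. It is 2-concave if $t\mapsto M(\sqrt t)$ is a concave function on $[0,\infty)$. The dual function is $M^*(t)=\sup_s(st-M(s))\in[0,\infty]$ (when $M'$ is invertible on $(0,\infty)$ this is $M^*(t)=\int_0^t{M'}^{-1}(s)\,ds$ for $t\ge 0$). The Orlicz norm of a real sequence $x=\{x_i\}_{i=1}^\infty$ is $$\|x\|_M=\sup\Big\{\sum_{i=1}^\infty x_iy_i \;:\; \sum_{i=1}^\infty M^*(y_i)\le 1\Big\},$$ and $l^M$ is the space of real sequences with $\|x\|_M<\infty$. $L^1$ denotes $L^1[0,1]$ with Lebesgue measure. *)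

theory Defs
  imports "HOL-Analysis.Analysis"
begin

definition orlicz_function :: "(real \<Rightarrow> real) \<Rightarrow> bool" where
  "orlicz_function M \<longleftrightarrow>
     convex_on UNIV M \<and> (\<forall>t. M (- t) = M t) \<and> M 0 = 0 \<and> (\<forall>t. t \<noteq> 0 \<longrightarrow> M t > 0)"

definition two_concave :: "(real \<Rightarrow> real) \<Rightarrow> bool" where
  "two_concave M \<longleftrightarrow> concave_on {0..} (\<lambda>t. M (sqrt t))"

text \<open>The dual function may be infinite: for \<open>M t = \<bar>t\<bar>\<close> it is \<open>0\<close> on \<open>{-1..1}\<close> and
  \<open>\<infinity>\<close> elsewhere.\<close>

definition orlicz_dual :: "(real \<Rightarrow> real) \<Rightarrow> real \<Rightarrow> ereal" where
  "orlicz_dual M t = (SUP s. ereal (s * t - M s))"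

text \<open>The norm is a supremum in the extended reals. Only those \<open>y\<close> enter for which
  \<open>\<Sum>i. x i * y i\<close> converges (\<^const>\<open>suminf\<close> is meaningless otherwise). This does not change
  the supremum: truncating an admissible \<open>y\<close> and changing signs of its entries keeps it
  admissible, so the supremum equals that of \<open>\<Sum>i. \<bar>x i * y i\<bar>\<close>, in \<open>[0, \<infinity>]\<close>, over all
  admissible \<open>y\<close>.\<close>

definition orlicz_enorm :: "(real \<Rightarrow> real) \<Rightarrow> (nat \<Rightarrow> real) \<Rightarrow> ereal" where
  "orlicz_enorm M x =
     (SUP y \<in> {y. (\<Sum>i. orlicz_dual M (y i)) \<le> 1 \<and> summable (\<lambda>i. x i * y i)}.
        ereal (\<Sum>i. x i * y i))"

definition orlicz_space :: "(real \<Rightarrow> real) \<Rightarrow> (nat \<Rightarrow> real) set" where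
  "orlicz_space M = {x. orlicz_enorm M x < \<infinity>}"

definition orlicz_norm :: "(real \<Rightarrow> real) \<Rightarrow> (nat \<Rightarrow> real) \<Rightarrow> real" where
  "orlicz_norm M x = real_of_ereal (orlicz_enorm M x)"

text \<open>Elements of \<open>L\<^sup>1[0,1]\<close> are represented by integrable functions; equality in \<open>L\<^sup>1\<close> is
  equality almost everywhere.\<close>

definition L1 :: "(real \<Rightarrow> real) set" where
  "L1 = {f. integrable (lebesgue_on {0..1}) f}"

definition L1_norm :: "(real \<Rightarrow> real) \<Rightarrow> real" where
  "L1_norm f = (\<integral>t. \<bar>f t\<bar> \<partial>lebesgue_on {0..1})"

definition L1_eq :: "(real \<Rightarrow> real) \<Rightarrow> (real \<Rightarrow> real) \<Rightarrow> bool" where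
  "L1_eq f g \<longleftrightarrow> (AE t in lebesgue_on {0..1}. f t = g t)"

definition linear_into_L1 :: "(nat \<Rightarrow> real) set \<Rightarrow> ((nat \<Rightarrow> real) \<Rightarrow> (real \<Rightarrow> real)) \<Rightarrow> bool" where
  "linear_into_L1 V T \<longleftrightarrow>
     (\<forall>x\<in>V. T x \<in> L1) \<and>
     (\<forall>x\<in>V. \<forall>y\<in>V. L1_eq (T (\<lambda>i. x i + y i)) (\<lambda>t. T x t + T y t)) \<and>
     (\<forall>c. \<forall>x\<in>V. L1_eq (T (\<lambda>i. c * x i)) (\<lambda>t. c * T x t))"

end

theory Submission
  imports Defs
begin

text \<open>
  The space is spanned in \<open>L\<^sup>1\<close> by independent symmetric functions \<open>f\<^sub>i\<close>, with laws chosen so that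
  \<open>E \<phi>(t f\<^sub>i)\<close> is comparable to \<open>M t\<close>, where \<open>\<phi> u = min (u\<^sup>2) \<bar>u\<bar>\<close>. For such functions
  \<open>E \<bar>\<Sum> x\<^sub>i f\<^sub>i\<bar>\<close> is of order \<open>1\<close> exactly when \<open>\<Sum> E \<phi>(x\<^sub>i f\<^sub>i)\<close> is: the upper bound comes from
  truncating at \<open>1\<close> and using orthogonality of the small parts, the lower bound from
  \<open>\<bar>u\<bar> \<ge> (\<Sum>k. 2\<^sup>k (1 - cos (u / 2\<^sup>k))) / 5\<close> and the product formula for \<open>E cos\<close>. By convexity and
  2-concavity \<open>M t / t\<close> is increasing and \<open>M t / t\<^sup>2\<close> decreasing, so \<open>M t / t\<close> is within a factor \<open>2\<close> of a
  concave function \<open>H\<close>, and on \<open>{0..1}\<close> the function \<open>t H t\<close> is a mixture of dilates of \<open>\<phi>\<close>.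

  Finitely many values suffice for each \<open>f\<^sub>i\<close> because an additive error \<open>\<epsilon>\<^sub>i\<close> with \<open>\<Sum> \<epsilon>\<^sub>i\<close> small is
  harmless. Hence the \<open>f\<^sub>i\<close> can be read off the digits of a mixed radix expansion of \<open>t\<close>, and
  \<open>M t = \<bar>t\<bar>\<close>, which no single integrable law can model, needs no separate treatment.
\<close>

section \<open>Limits in mean and completeness of the space of integrable functions\<close>

text \<open>Integrability belongs to the relation because the Bochner integral of a non-integrable
  function is 0, so the last condition alone would carry no information.\<close>

definition L1_limit :: "'a measure \<Rightarrow> (nat \<Rightarrow> 'a \<Rightarrow> real) \<Rightarrow> ('a \<Rightarrow> real) \<Rightarrow> bool" where
  "L1_limit M F g \<longleftrightarrow> (\<forall>n. integrable M (F n)) \<and> integrable M g \<and>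
     (\<lambda>n. \<integral>t. \<bar>F n t - g t\<bar> \<partial>M) \<longlonglongrightarrow> 0"

lemma L1_limitD:
  assumes "L1_limit M F g"
  shows "integrable M (F n)" "integrable M g" "(\<lambda>n. \<integral>t. \<bar>F n t - g t\<bar> \<partial>M) \<longlonglongrightarrow> 0"
  using assms unfolding L1_limit_def by simp_all

text \<open>The distance of \<open>g\<close> and \<open>h\<close> is at most the sum of their
  distances to \<open>F n\<close>, which tends to 0. Linearity of an operator defined by choosing a
  limit rests on this.\<close>

lemma L1_limit_unique:
  assumes "L1_limit M F g" "L1_limit M F h"
  shows "AE t in M. g t = h t"
proof -
  note [simp] = L1_limitD(1,2)[OF assms(1)] L1_limitD(1,2)[OF assms(2)]
  have "(\<lambda>n. (\<integral>t. \<bar>F n t - g t\<bar> \<partial>M) + (\<integral>t. \<bar>F n t - h t\<bar> \<partial>M)) \<longlonglongrightarrow> 0 + 0"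
    by (intro tendsto_add L1_limitD assms)
  moreover have "(\<integral>t. \<bar>g t - h t\<bar> \<partial>M) \<le> (\<integral>t. \<bar>F n t - g t\<bar> \<partial>M) + (\<integral>t. \<bar>F n t - h t\<bar> \<partial>M)" for n
  proof -
    have "(\<integral>t. \<bar>g t - h t\<bar> \<partial>M) \<le> (\<integral>t. \<bar>F n t - g t\<bar> + \<bar>F n t - h t\<bar> \<partial>M)"
      by (rule integral_mono) auto
    then show ?thesis by simp
  qed
  ultimately have "(\<integral>t. \<bar>g t - h t\<bar> \<partial>M) \<le> 0"
    using LIMSEQ_le_const[of _ "0 + 0 :: real"] by fastforce
  moreover have "0 \<le> (\<integral>t. \<bar>g t - h t\<bar> \<partial>M)"
    by simp
  ultimately have "(\<integral>t. \<bar>g t - h t\<bar> \<partial>M) = 0"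
    by simp
  then have "AE t in M. \<bar>g t - h t\<bar> = 0"
    by (subst (asm) integral_nonneg_eq_0_iff_AE) auto
  then show ?thesis by simp
qed

lemma L1_limit_add:
  assumes "L1_limit M F g" "L1_limit M G h"
  shows "L1_limit M (\<lambda>n t. F n t + G n t) (\<lambda>t. g t + h t)"
  unfolding L1_limit_def
proof (intro conjI allI)
  note [simp] = L1_limitD(1,2)[OF assms(1)] L1_limitD(1,2)[OF assms(2)]
  show "integrable M (\<lambda>t. F n t + G n t)" "integrable M (\<lambda>t. g t + h t)" for n
    by auto
  have "(\<lambda>n. (\<integral>t. \<bar>F n t - g t\<bar> \<partial>M) + (\<integral>t. \<bar>G n t - h t\<bar> \<partial>M)) \<longlonglongrightarrow> 0"
    using tendsto_add[OF assms[THEN L1_limitD(3)]] by simp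
  moreover have "norm (\<integral>t. \<bar>F n t + G n t - (g t + h t)\<bar> \<partial>M)
      \<le> (\<integral>t. \<bar>F n t - g t\<bar> \<partial>M) + (\<integral>t. \<bar>G n t - h t\<bar> \<partial>M)" for n
  proof -
    have "(\<integral>t. \<bar>F n t + G n t - (g t + h t)\<bar> \<partial>M) \<le> (\<integral>t. \<bar>F n t - g t\<bar> + \<bar>G n t - h t\<bar> \<partial>M)"
      by (rule integral_mono) auto
    then show ?thesis by simp
  qed
  ultimately show "(\<lambda>n. \<integral>t. \<bar>F n t + G n t - (g t + h t)\<bar> \<partial>M) \<longlonglongrightarrow> 0"
    by (rule Lim_null_comparison[OF always_eventually[OF allI], rotated])
qed

lemma L1_limit_cmult:
  assumes "L1_limit M F g"
  shows "L1_limit M (\<lambda>n t. c * F n t) (\<lambda>t. c * g t)"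
  unfolding L1_limit_def
proof (intro conjI allI)
  have "(\<lambda>n. \<bar>c\<bar> * (\<integral>t. \<bar>F n t - g t\<bar> \<partial>M)) \<longlonglongrightarrow> \<bar>c\<bar> * 0"
    by (intro tendsto_intros L1_limitD assms)
  then show "(\<lambda>n. \<integral>t. \<bar>c * F n t - c * g t\<bar> \<partial>M) \<longlonglongrightarrow> 0"
    by (simp add: abs_mult flip: right_diff_distrib)
qed (use assms in \<open>auto simp: L1_limit_def\<close>)

lemma L1_limit_norm:
  assumes "L1_limit M F g"
  shows "(\<lambda>n. \<integral>t. \<bar>F n t\<bar> \<partial>M) \<longlonglongrightarrow> (\<integral>t. \<bar>g t\<bar> \<partial>M)"
proof -
  note [simp] = L1_limitD(1,2)[OF assms]
  have "norm ((\<integral>t. \<bar>F n t\<bar> \<partial>M) - (\<integral>t. \<bar>g t\<bar> \<partial>M)) \<le> (\<integral>t. \<bar>F n t - g t\<bar> \<partial>M)" for n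
  proof -
    have "norm ((\<integral>t. \<bar>F n t\<bar> \<partial>M) - (\<integral>t. \<bar>g t\<bar> \<partial>M)) = norm (\<integral>t. \<bar>F n t\<bar> - \<bar>g t\<bar> \<partial>M)"
      by (subst Bochner_Integration.integral_diff) auto
    also have "\<dots> \<le> (\<integral>t. norm (\<bar>F n t\<bar> - \<bar>g t\<bar>) \<partial>M)"
      by (rule integral_norm_bound)
    also have "\<dots> \<le> (\<integral>t. \<bar>F n t - g t\<bar> \<partial>M)"
      by (intro integral_mono) auto
    finally show ?thesis .
  qed
  then have "(\<lambda>n. (\<integral>t. \<bar>F n t\<bar> \<partial>M) - (\<integral>t. \<bar>g t\<bar> \<partial>M)) \<longlonglongrightarrow> 0"
    by (intro Lim_null_comparison[OF _ L1_limitD(3)[OF assms]]) auto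
  then show ?thesis by (simp add: LIM_zero_iff)
qed

text \<open>Some subsequence is Cauchy almost everywhere; Fatou's lemma along it bounds the distance
  from \<open>s n\<close> to the pointwise limit.\<close>

lemma L1_complete:
  fixes s :: "nat \<Rightarrow> 'a \<Rightarrow> 'b :: {banach, second_countable_topology}"
  assumes s: "\<And>n. integrable M (s n)"
    and Cauchy: "\<And>e. e > 0 \<Longrightarrow> \<exists>N. \<forall>i\<ge>N. \<forall>j\<ge>N. (LINT x|M. norm (s i x - s j x)) < e"
  obtains g where "integrable M g" "(\<lambda>n. LINT x|M. norm (s n x - g x)) \<longlonglongrightarrow> 0"
proof -
  note [measurable] = borel_measurable_integrable[OF s]
  obtain r where r: "strict_mono r" and AE_Cauchy: "AE x in M. Cauchy (\<lambda>i. s (r i) x)"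
    using cauchy_L1_AE_cauchy_subseq[OF s Cauchy] by blast
  \<comment> \<open>Where the subsequence diverges \<open>lim\<close> is unspecified, but such
    points form a null set.\<close>
  define g where "g x = lim (\<lambda>i. s (r i) x)" for x
  have [measurable]: "g \<in> borel_measurable M"
    unfolding g_def by measurable
  have bound: "(\<integral>\<^sup>+x. norm (s n x - g x) \<partial>M) \<le> ennreal e"
    if N: "\<forall>i\<ge>N. \<forall>j\<ge>N. (LINT x|M. norm (s i x - s j x)) < e" and "n \<ge> N" for n N e
  proof -
    have "AE x in M. ennreal (norm (s n x - g x)) = liminf (\<lambda>i. ennreal (norm (s n x - s (r i) x)))"
      using AE_Cauchy
    proof eventually_elim
      case (elim x)
      then have "(\<lambda>i. s (r i) x) \<longlonglongrightarrow> g x"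
        unfolding g_def by (simp add: Cauchy_convergent_iff convergent_LIMSEQ_iff)
      then have "(\<lambda>i. ennreal (norm (s n x - s (r i) x))) \<longlonglongrightarrow> ennreal (norm (s n x - g x))"
        by (intro tendsto_intros)
      then show ?case by (metis lim_imp_Liminf trivial_limit_sequentially)
    qed
    then have "(\<integral>\<^sup>+x. norm (s n x - g x) \<partial>M)
        = (\<integral>\<^sup>+x. liminf (\<lambda>i. ennreal (norm (s n x - s (r i) x))) \<partial>M)"
      by (rule nn_integral_cong_AE)
    also have "\<dots> \<le> liminf (\<lambda>i. \<integral>\<^sup>+x. norm (s n x - s (r i) x) \<partial>M)"
      by (rule nn_integral_liminf) measurable
    also have "\<dots> \<le> ennreal e"
    proof (rule Liminf_le)
      show "\<forall>\<^sub>F i in sequentially. (\<integral>\<^sup>+x. norm (s n x - s (r i) x) \<partial>M) \<le> ennreal e"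
        using eventually_ge_at_top[of N]
      proof eventually_elim
        case (elim i)
        then have "r i \<ge> N" using seq_suble[OF r, of i] by simp
        then show ?case
          using N \<open>n \<ge> N\<close> s by (subst nn_integral_eq_integral) (auto intro!: ennreal_leI intro: less_imp_le)
      qed
    qed simp
    finally show ?thesis .
  qed
  have diff: "integrable M (\<lambda>x. s n x - g x)" if "\<forall>i\<ge>n. \<forall>j\<ge>n. (LINT x|M. norm (s i x - s j x)) < 1" for n
    using bound[OF that order_refl] 
    by (intro integrableI_bounded) (auto intro: le_less_trans)
  obtain n0 where n0: "\<forall>i\<ge>n0. \<forall>j\<ge>n0. (LINT x|M. norm (s i x - s j x)) < 1"
    using Cauchy[of 1] by auto
  have g: "integrable M g"
    using Bochner_Integration.integrable_diff[OF s[of n0] diff[OF n0]] by simp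
  have "(\<lambda>n. LINT x|M. norm (s n x - g x)) \<longlonglongrightarrow> 0"
  proof (rule LIMSEQ_I)
    fix e :: real assume "e > 0"
    then obtain N where N: "\<forall>i\<ge>N. \<forall>j\<ge>N. (LINT x|M. norm (s i x - s j x)) < e / 2"
      using Cauchy[of "e/2"] by auto
    have "norm ((LINT x|M. norm (s n x - g x)) - 0) < e" if "n \<ge> N" for n
    proof -
      have "ennreal (LINT x|M. norm (s n x - g x)) \<le> ennreal (e / 2)"
        using bound[OF N that] s g by (subst (asm) nn_integral_eq_integral) auto
      then have "(LINT x|M. norm (s n x - g x)) \<le> e / 2"
        using \<open>e > 0\<close> by simp
      then show ?thesis
        using \<open>e > 0\<close> by simp
    qed
    then show "\<exists>N. \<forall>n\<ge>N. norm ((LINT x|M. norm (s n x - g x)) - 0) < e" by blast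
  qed
  with g show thesis by (rule that)
qed

section \<open>Independence of mixed radix digits\<close>

lemma measurable_nat_floor_mult:
  "(\<lambda>t :: real. nat \<lfloor>c * t\<rfloor>) \<in> measurable (lebesgue_on S) (count_space UNIV)"
proof -
  have "(\<lambda>t :: real. nat \<lfloor>c * t\<rfloor>) \<in> measurable borel (count_space UNIV)"
    by measurable
  then show ?thesis
    by (intro measurable_restrict_space1 measurable_completion) simp
qed

text \<open>The integrand is constant on each of \<open>P\<close> intervals of length
  \<open>1 / P\<close>.\<close>

lemma integral_step_function:
  fixes F :: "nat \<Rightarrow> 'a :: {real_normed_field, banach, second_countable_topology}"
  assumes "P > 0"
  shows "(\<integral>t. F (nat \<lfloor>real P * t\<rfloor>) \<partial>lebesgue_on {0..1}) = (\<Sum>N<P. F N) / of_nat P"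
proof -
  let ?L = "lebesgue_on {0..1::real}"
  let ?I = "\<lambda>N. {real N / real P ..< real (Suc N) / real P}"
  have sub: "?I N \<subseteq> {0..1}" if "N < P" for N
  proof
    fix t assume t: "t \<in> ?I N"
    have "real (Suc N) / real P \<le> 1" using that assms by simp
    moreover have "0 \<le> real N / real P" by simp
    ultimately show "t \<in> {0..1}" 
      using t order_trans[of 0 "real N / real P" t] unfolding atLeastAtMost_iff atLeastLessThan_iff by linarith
  qed
  have sets: "?I N \<in> sets ?L" if "N < P" for N
    using sub[OF that] by (auto simp: sets_restrict_space_iff)
  have meas: "measure ?L (?I N) = 1 / real P" if "N < P" for N
    using sub[OF that] assms by (subst measure_restrict_space) (auto simp: field_simps)
  have fin: "emeasure ?L (?I N) < \<infinity>" if "N < P" for N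
    using sub[OF that] assms by (subst emeasure_restrict_space) (auto simp: field_simps)
  \<comment> \<open>At \<open>t = 1\<close> the floor is \<open>P\<close>, an index outside the sum,
    so the right endpoint is discarded.\<close>
  have "AE t in ?L. t \<noteq> 1"
  proof (rule AE_I)
    show "{t \<in> space ?L. \<not> t \<noteq> 1} \<subseteq> {1}" by auto
    show "emeasure ?L {1} = 0"
      by (subst emeasure_restrict_space) auto
    show "{1} \<in> sets ?L" by (auto simp: sets_restrict_space_iff)
  qed
  then have "AE t in ?L. F (nat \<lfloor>real P * t\<rfloor>) = (\<Sum>N<P. indicat_real (?I N) t *\<^sub>R F N)"
  proof (rule AE_mp, intro AE_I2 impI)
    fix t assume "t \<in> space ?L" and "t \<noteq> 1"
    then have t: "0 \<le> t" "t < 1" by auto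
    define K where "K = nat \<lfloor>real P * t\<rfloor>"
    have K: "real K \<le> real P * t" "real P * t < real K + 1"
      using t by (auto simp: K_def)
    have "real P * t < real P" using t assms by simp
    with K have "K < P" by linarith
    have ind: "indicat_real (?I N) t = (if N = K then 1 else 0)" for N
    proof (cases "N = K")
      case True
      then show ?thesis using K assms by (auto simp: indicator_def field_simps)
    next
      case False
      have "\<not> (real N \<le> real P * t \<and> real P * t < real N + 1)"
        using floor_eq4[of N "real P * t"] K_def False by auto
      then show ?thesis using False assms by (auto simp: indicator_def field_simps)
    qed
    show "F (nat \<lfloor>real P * t\<rfloor>) = (\<Sum>N<P. indicat_real (?I N) t *\<^sub>R F N)"
      using \<open>K < P\<close> unfolding ind K_def[symmetric]
      by (simp add: if_distrib[of "\<lambda>c. c *\<^sub>R _"] cong: if_cong)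
  qed
  then have "(\<integral>t. F (nat \<lfloor>real P * t\<rfloor>) \<partial>?L)
      = (\<integral>t. (\<Sum>N<P. indicat_real (?I N) t *\<^sub>R F N) \<partial>?L)"
    by (intro integral_cong_AE borel_measurable_sum borel_measurable_scaleR borel_measurable_indicator
        sets measurable_compose[OF measurable_nat_floor_mult]) auto
  also have "\<dots> = (\<Sum>N<P. (1 / real P) *\<^sub>R F N)"
    using meas fin sets sub
    by (subst Bochner_Integration.integral_sum) (auto intro!: sum.cong simp: Int_absorb2 simp del: of_nat_Suc)
  finally show ?thesis
    by (simp add: scaleR_conv_of_real sum_divide_distrib)
qed

text \<open>A product over the mixed radix digits of \<open>N\<close>. The least significant digit
  carries the largest index, because refining the partition of the unit interval appends a digit at
  the end.\<close>

primrec digit_prod :: "(nat \<Rightarrow> nat) \<Rightarrow> (nat \<Rightarrow> nat \<Rightarrow> 'a :: comm_monoid_mult) \<Rightarrow> nat \<Rightarrow> nat \<Rightarrow> 'a" where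
  "digit_prod m u 0 N = 1"
| "digit_prod m u (Suc n) N = digit_prod m u n (N div m n) * u n (N mod m n)"

text \<open>The distributive law: the numbers below the product of the bases are in bijection with
  the digit tuples. A block of \<open>m n\<close> consecutive numbers shares all digits but the
  last.\<close>

lemma sum_digit_prod:
  fixes u :: "nat \<Rightarrow> nat \<Rightarrow> 'a :: comm_semiring_1"
  assumes "\<And>i. m i > 0"
  shows "(\<Sum>N<(\<Prod>i<n. m i). digit_prod m u n N) = (\<Prod>i<n. \<Sum>d<m i. u i d)"
proof (induction n)
  case (Suc n)
  let ?P = "\<Prod>i<n. m i"
  have "(\<Sum>N<(\<Prod>i<Suc n. m i). digit_prod m u (Suc n) N)
      = (\<Sum>q<?P. \<Sum>N=q * m n..<q * m n + m n. digit_prod m u n (N div m n) * u n (N mod m n))"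
    by (simp add: sum.nat_group)
  also have "\<dots> = (\<Sum>q<?P. \<Sum>d<m n. digit_prod m u n q * u n d)"
  proof (rule sum.cong[OF refl])
    fix q
    show "(\<Sum>N=q * m n..<q * m n + m n. digit_prod m u n (N div m n) * u n (N mod m n))
        = (\<Sum>d<m n. digit_prod m u n q * u n d)"
    proof (rule sum.reindex_bij_witness[where i = "\<lambda>d. q * m n + d" and j = "\<lambda>N. N - q * m n"])
      fix N assume "N \<in> {q * m n..<q * m n + m n}"
      then obtain d where "N = q * m n + d" "d < m n"
        by (metis atLeastLessThan_iff le_Suc_ex nat_add_left_cancel_less)
      then show "digit_prod m u n q * u n (N - q * m n) = digit_prod m u n (N div m n) * u n (N mod m n)"
        by simp
    qed auto
  qed
  also have "\<dots> = (\<Prod>i<Suc n. \<Sum>d<m i. u i d)"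
    by (simp add: Suc.IH[symmetric] sum_product)
  finally show ?case .
qed simp

text \<open>The digit at place \<open>n\<close> after the radix point in the Cantor series expansion
  of \<open>t\<close> with bases \<open>m 0\<close>, \<open>m 1\<close>, and so on.\<close>

definition cantor_digit :: "(nat \<Rightarrow> nat) \<Rightarrow> nat \<Rightarrow> real \<Rightarrow> nat" where
  "cantor_digit m n t = nat \<lfloor>real (\<Prod>i<Suc n. m i) * t\<rfloor> mod m n"

text \<open>Taking the floor commutes with dropping the last digit, so all the first
  \<open>n\<close> digits of \<open>t\<close> can be read off one integer. This makes the product a
  step function of \<open>t\<close>.\<close>

lemma prod_cantor_digit:
  assumes "\<And>i. m i > 0" and "t \<ge> 0"
  shows "(\<Prod>i<n. u i (cantor_digit m i t)) = digit_prod m u n (nat \<lfloor>real (\<Prod>i<n. m i) * t\<rfloor>)"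
proof (induction n)
  case (Suc n)
  let ?P = "\<Prod>i<n. m i"
  have "nat \<lfloor>real (?P * m n) * t\<rfloor> div m n = nat \<lfloor>real ?P * t\<rfloor>"
  proof -
    have "\<lfloor>real (?P * m n) * t / real_of_int (int (m n))\<rfloor> = \<lfloor>real (?P * m n) * t\<rfloor> div int (m n)"
      by (rule floor_divide_real_eq_div) simp
    moreover have "real (?P * m n) * t / real_of_int (int (m n)) = real ?P * t"
      using assms(1)[of n] by simp
    ultimately show ?thesis
      using assms by (metis floor_eq_iff nat_div_distrib' nat_int of_nat_0_le_iff)
  qed
  then show ?case
    by (simp add: Suc.IH cantor_digit_def[of m n] del: of_nat_mult of_nat_prod)
qed simp

text \<open>This is independence and uniform distribution of the digits, in the form of expectations
  of products. The values may be complex, which characteristic functions require.\<close>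

lemma integral_prod_cantor_digit:
  fixes u :: "nat \<Rightarrow> nat \<Rightarrow> 'a :: {real_normed_field, banach, second_countable_topology}"
  assumes "\<And>i. m i > 0"
  shows "(\<integral>t. (\<Prod>i<n. u i (cantor_digit m i t)) \<partial>lebesgue_on {0..1})
       = (\<Prod>i<n. (\<Sum>d<m i. u i d) / of_nat (m i))"
proof -
  let ?P = "\<Prod>i<n. m i"
  have "(\<integral>t. (\<Prod>i<n. u i (cantor_digit m i t)) \<partial>lebesgue_on {0..1})
      = (\<integral>t. digit_prod m u n (nat \<lfloor>real ?P * t\<rfloor>) \<partial>lebesgue_on {0..1})"
    using assms by (intro Bochner_Integration.integral_cong) (auto simp: prod_cantor_digit)
  also have "\<dots> = (\<Sum>N<?P. digit_prod m u n N) / of_nat ?P"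
    using assms by (intro integral_step_function) (auto simp: prod_pos)
  also have "\<dots> = (\<Prod>i<n. (\<Sum>d<m i. u i d) / of_nat (m i))"
    using assms by (simp add: sum_digit_prod prod_dividef)
  finally show ?thesis .
qed

lemma measurable_cantor_digit [measurable]:
  "cantor_digit m n \<in> measurable (lebesgue_on {0..1}) (count_space UNIV)"
    unfolding cantor_digit_def
  by (rule measurable_compose[OF measurable_nat_floor_mult]) simp

section \<open>Quadratic-linear truncation and lacunary cosine sums\<close>

text \<open>The function \<open>\<phi>\<close> of the opening comment.\<close>

definition quad_lin :: "real \<Rightarrow> real" where
  "quad_lin u = min (u\<^sup>2) \<bar>u\<bar>"

lemma quad_lin_nonneg [simp]: "0 \<le> quad_lin u"
  by (simp add: quad_lin_def)

lemma quad_lin_minus [simp]: "quad_lin (- u) = quad_lin u"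
  by (simp add: quad_lin_def)

lemma quad_lin_0 [simp]: "quad_lin 0 = 0"
  by (simp add: quad_lin_def)

lemma quad_lin_mono: "\<bar>u\<bar> \<le> \<bar>v\<bar> \<Longrightarrow> quad_lin u \<le> quad_lin v"
  by (auto simp: quad_lin_def abs_le_square_iff[symmetric] min_le_iff_disj)

lemma quad_lin_le_abs: "quad_lin u \<le> \<bar>u\<bar>"
  by (simp add: quad_lin_def)

text \<open>Taylor expansion gives \<open>u^2 / 2 - u^4 / 24\<close> as a lower bound, and
  \<open>u^2 \<le> 4\<close> makes the last term at most \<open>u^2 / 6\<close>.\<close>

lemma one_minus_cos_ge:
  fixes u :: real
  assumes "\<bar>u\<bar> \<le> 2"
  shows "u\<^sup>2 / 3 \<le> 1 - cos u"
proof -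
  have *: "u\<^sup>2 / 3 \<le> 1 - cos u" if "0 < u" "u \<le> 2" for u :: real
  proof -
    obtain t where t: "cos u = (\<Sum>m<4. cos_coeff m * u ^ m) + cos (t + 1/2 * real 4 * pi) / fact 4 * u ^ 4"
      using Maclaurin_cos_expansion2[of u 4] \<open>0 < u\<close> by fastforce
    have "(\<Sum>m<4. cos_coeff m * u ^ m) = 1 - u\<^sup>2 / 2"
    proof -
      have "{..<4} = {0, 1, 2, 3 :: nat}" by auto
      then show ?thesis by (simp add: cos_coeff_def)
    qed
    with t have "cos u = 1 - u\<^sup>2 / 2 + cos (t + 2 * pi) / 24 * u ^ 4"
      by (simp add: fact_numeral)
    also have "\<dots> \<le> 1 - u\<^sup>2 / 2 + 1 / 24 * u ^ 4"
      by (intro add_left_mono mult_right_mono divide_right_mono) auto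
    also have "u ^ 4 \<le> 4 * u\<^sup>2"
      using mult_right_mono[of "u\<^sup>2" 4 "u\<^sup>2"] that power_mono[of u 2 2] by (simp add: power4_eq_xxxx power2_eq_square)
    finally show ?thesis by simp
  qed
  show ?thesis
    using *[of u] *[of "-u"] assms by (cases "u = 0"; cases "u > 0") auto
qed

lemma one_minus_cos_le:
  fixes u :: real
  shows "1 - cos u \<le> u\<^sup>2 / 2"
proof -
  have "1 - cos u = 2 * (sin (u / 2))\<^sup>2"
    using cos_double_sin[of "u/2"] by simp
  also have "(sin (u / 2))\<^sup>2 \<le> (u / 2)\<^sup>2"
    using abs_sin_x_le_abs_x[of "u/2"] by (simp only: abs_le_square_iff) 
  finally show ?thesis by (simp add: power_divide)
qed

text \<open>A dyadic discretization of the integral of \<open>(1 - cos (s u)) / s^2\<close> over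
  \<open>0 < s \<le> 1\<close>, with \<open>s = 1 / 2^k\<close>. Over all positive \<open>s\<close>
  that integral is a constant multiple of \<open>\<bar>u\<bar>\<close>; the cutoff at 1 produces
  quadratic behaviour near 0.\<close>

definition lacunary_cos :: "nat \<Rightarrow> real \<Rightarrow> real" where
  "lacunary_cos K u = (\<Sum>k<K. 2 ^ k * (1 - cos (u / 2 ^ k)))"

lemma lacunary_cos_le: "lacunary_cos K u \<le> 5 * \<bar>u\<bar>"
proof -
  have term1: "2 ^ k * (1 - cos (u / 2 ^ k)) \<le> 2 * 2 ^ k" for k
    using mult_left_mono[of "1 - cos (u / 2 ^ k)" 2 "2 ^ k"] cos_ge_minus_one[of "u / 2 ^ k"] by simp
  have term2: "2 ^ k * (1 - cos (u / 2 ^ k)) \<le> u\<^sup>2 / (2 * 2 ^ k)" for k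
    using mult_left_mono[OF one_minus_cos_le[of "u / 2 ^ k"], of "2 ^ k"]
    by (simp add: power_divide power2_eq_square)
  have small: "lacunary_cos K u \<le> 2 * 2 ^ K" for K
  proof (induction K)
    case (Suc K)
    then show ?case using term1[of K] unfolding lacunary_cos_def sum.lessThan_Suc power_Suc by linarith
  qed (simp add: lacunary_cos_def)
  \<comment> \<open>The subtracted term is the tail from \<open>K\<close> on of the geometric series
    in \<open>term2\<close>; it lets the induction close. At the first \<open>K\<close> with
    \<open>\<bar>u\<bar> \<le> 2^K\<close>, if it is positive, \<open>small\<close> costs at most
    \<open>4 * \<bar>u\<bar>\<close> and the tail at most \<open>\<bar>u\<bar>\<close>, whence
    5.\<close>
  have "\<bar>u\<bar> \<le> 2 ^ K \<Longrightarrow> lacunary_cos K u \<le> 5 * \<bar>u\<bar> - u\<^sup>2 / 2 ^ K"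
  proof (induction K)
    case 0
    then have "u\<^sup>2 \<le> \<bar>u\<bar>" 
      using mult_left_mono[of "\<bar>u\<bar>" 1 "\<bar>u\<bar>"] by (simp add: power2_eq_square)
    then show ?case by (simp add: lacunary_cos_def)
  next
    case (Suc K)
    show ?case
    proof (cases "\<bar>u\<bar> \<le> 2 ^ K")
      case True
      have "u\<^sup>2 / 2 ^ K = u\<^sup>2 / (2 * 2 ^ K) + u\<^sup>2 / 2 ^ Suc K" by (simp add: field_simps)
      then show ?thesis using Suc.IH[OF True] term2[of K] by (simp add: lacunary_cos_def)
    next
      case False
      have "u\<^sup>2 / 2 ^ Suc K \<le> \<bar>u\<bar>"
        using mult_left_mono[OF Suc.prems, of "\<bar>u\<bar>"] by (simp add: power2_eq_square field_simps)
      then show ?thesis using False small[of "Suc K"] by simp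
    qed
  qed
  then show ?thesis
    using small[of K] by (cases "\<bar>u\<bar> \<le> 2 ^ K") (auto intro: order_trans[of _ "5 * \<bar>u\<bar> - u\<^sup>2 / 2 ^ K"])
qed

text \<open>A single term suffices: the one with \<open>u / 2^k\<close> of modulus between 1 and 2,
  or \<open>k = 0\<close> for small \<open>u\<close>. The bound on \<open>u\<close> guarantees that
  this index occurs in the sum.\<close>

lemma lacunary_cos_ge:
  assumes "\<bar>u\<bar> < 2 ^ K" and "K > 0"
  shows "quad_lin u / 3 \<le> lacunary_cos K u"
proof -
  have nonneg: "0 \<le> 2 ^ k * (1 - cos (u / 2 ^ k))" for k by simp
  have ge: "2 ^ k * (1 - cos (u / 2 ^ k)) \<le> lacunary_cos K u" if "k < K" for k
    unfolding lacunary_cos_def using that nonneg by (intro member_le_sum) auto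
  show ?thesis
  proof (cases "\<bar>u\<bar> \<le> 1")
    case True
    have "quad_lin u \<le> u\<^sup>2" by (simp add: quad_lin_def)
    then show ?thesis
      using one_minus_cos_ge[of u] True ge[OF \<open>K > 0\<close>] by simp
  next
    case False
    define j where "j = (LEAST j. \<bar>u\<bar> < 2 ^ j)"
    have j: "\<bar>u\<bar> < 2 ^ j" unfolding j_def using assms(1) by (rule LeastI)
    have "j \<le> K" unfolding j_def using assms(1) by (rule Least_le)
    have "j \<noteq> 0" using j False by (cases j) auto
    then obtain k where k: "j = Suc k" by (cases j) auto
    then have "\<not> \<bar>u\<bar> < 2 ^ k" using not_less_Least[of k "\<lambda>j. \<bar>u\<bar> < 2 ^ j"] by (simp add: j_def)
    then have u: "2 ^ k \<le> \<bar>u\<bar>" "\<bar>u\<bar> \<le> 2 * 2 ^ k" using j k by auto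
    have "quad_lin u \<le> \<bar>u\<bar>" by (simp add: quad_lin_def)
    also have "\<bar>u\<bar> \<le> 2 ^ k * (u / 2 ^ k)\<^sup>2"
      using mult_right_mono[OF u(1), of "\<bar>u\<bar>"] by (simp add: field_simps power2_eq_square)
    also have "\<dots> / 3 \<le> 2 ^ k * (1 - cos (u / 2 ^ k))"
      using mult_left_mono[OF one_minus_cos_ge[of "u / 2 ^ k"], of "2 ^ k"] u by (simp add: field_simps)
    finally show ?thesis using ge[of k] \<open>j \<le> K\<close> k by simp
  qed
qed

lemma one_minus_cos_le_quad_lin: "1 - cos u \<le> 2 * quad_lin u"
proof (cases "\<bar>u\<bar> \<le> 1")
  case True
  then have "u\<^sup>2 \<le> \<bar>u\<bar>"
    using mult_left_mono[of "\<bar>u\<bar>" 1 "\<bar>u\<bar>"] by (simp add: power2_eq_square)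
  then have "quad_lin u = u\<^sup>2" by (simp add: quad_lin_def)
  then show ?thesis
    using one_minus_cos_le[of u] zero_le_power2[of u] by linarith
next
  case False
  then have "\<bar>u\<bar> \<le> u\<^sup>2"
    using mult_left_mono[of 1 "\<bar>u\<bar>" "\<bar>u\<bar>"] by (simp add: power2_eq_square)
  moreover have "1 - cos u \<le> 2"
    using cos_ge_minus_one[of u] by linarith
  ultimately show ?thesis
    using False unfolding quad_lin_def by linarith
qed

text \<open>Bounds the product by \<open>exp (- P)\<close> and then by \<open>1 / (1 + P)\<close>,
  where \<open>P\<close> is the sum of the \<open>p i\<close>. Having \<open>B\<close> in the
  denominator keeps the estimate linear in \<open>p\<close>, so it can be added up over many
  scales.\<close>

lemma one_minus_prod_ge:
  fixes p :: "'a \<Rightarrow> real"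
  assumes "finite I" and "\<And>i. i \<in> I \<Longrightarrow> 0 \<le> p i" "\<And>i. i \<in> I \<Longrightarrow> p i \<le> 1"
    and "(\<Sum>i\<in>I. p i) \<le> B"
  shows "(\<Sum>i\<in>I. p i) / (1 + B) \<le> 1 - (\<Prod>i\<in>I. 1 - p i)"
proof -
  let ?P = "\<Sum>i\<in>I. p i"
  have P: "0 \<le> ?P" using assms by (intro sum_nonneg)
  have "(\<Prod>i\<in>I. 1 - p i) \<le> (\<Prod>i\<in>I. exp (- p i))"
    using assms exp_ge_add_one_self[of "- p _"] by (intro prod_mono) auto
  also have "\<dots> = exp (- ?P)"
    using assms(1) by (simp add: exp_sum sum_negf[symmetric])
  also have "\<dots> \<le> 1 / (1 + ?P)"
    using P exp_ge_add_one_self[of ?P] by (simp add: exp_minus field_simps)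
  finally have "?P / (1 + ?P) \<le> 1 - (\<Prod>i\<in>I. 1 - p i)"
    using P by (simp add: field_simps)
  moreover have "?P / (1 + B) \<le> ?P / (1 + ?P)"
    using P assms(4) by (intro divide_left_mono) auto
  ultimately show ?thesis by linarith
qed

section \<open>Sums of independent symmetric functions\<close>

text \<open>Assumption \<open>lazy\<close> says that at least half of the entries are \<open>0\<close>. It makes all factors of the
  product formula for \<open>E cos\<close> nonnegative.\<close>

locale symmetric_digits =
  fixes as :: "nat \<Rightarrow> real list"
  assumes nonempty: "as i \<noteq> []"
    and odd_sum: "\<And>u :: real \<Rightarrow> real. (\<And>a. u (- a) = - u a) \<Longrightarrow> (\<Sum>a\<leftarrow>as i. u a) = 0"
    and lazy: "\<And>u :: real \<Rightarrow> real. (\<And>a. - 1 \<le> u a) \<Longrightarrow> u 0 = 1 \<Longrightarrow> 0 \<le> (\<Sum>a\<leftarrow>as i. u a)"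
begin

abbreviation unit_measure :: "real measure" where
  "unit_measure \<equiv> lebesgue_on {0..1}"

text \<open>A uniform digit serves as an index into the list, so a value has probability
  proportional to its multiplicity. Different \<open>i\<close> use different digits and are
  therefore independent.\<close>

definition rv :: "nat \<Rightarrow> real \<Rightarrow> real" where
  "rv i t = as i ! cantor_digit (\<lambda>i. length (as i)) i t"

text \<open>The expectation of \<open>u (rv i t)\<close> in \<open>t\<close>, as
  \<open>integral_rv\<close> confirms.\<close>

definition avg :: "nat \<Rightarrow> (real \<Rightarrow> real) \<Rightarrow> real" where
  "avg i u = (\<Sum>a\<leftarrow>as i. u a) / real (length (as i))"

lemma length_pos: "0 < length (as i)"
  using nonempty by simp

lemma rv_in_set: "rv i t \<in> set (as i)"
  using length_pos[of i] by (simp add: rv_def cantor_digit_def)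

lemma finite_measure_unit: "finite_measure unit_measure"
  by (intro finite_measure_lebesgue_on) simp

lemma measure_unit: "measure unit_measure {0..1} = 1"
  by (simp add: measure_restrict_space)

lemma measurable_rv: "(\<lambda>t. u (rv i t)) \<in> borel_measurable unit_measure"
  unfolding rv_def by (rule measurable_compose[OF measurable_cantor_digit]) simp

lemma norm_rv_le: "norm (u (rv i t)) \<le> (\<Sum>a\<in>set (as i). norm (u a))"
  using rv_in_set by (intro member_le_sum) auto

lemma integrable_rv:
  fixes u :: "real \<Rightarrow> 'a :: {banach, second_countable_topology}"
  shows "integrable unit_measure (\<lambda>t. u (rv i t))"
  using norm_rv_le
  by (intro finite_measure.integrable_const_bound[OF finite_measure_unit] AE_I2 measurable_rv)

lemma integrable_rv_mult:
  fixes u v :: "real \<Rightarrow> real"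
  shows "integrable unit_measure (\<lambda>t. u (rv i t) * v (rv j t))"
  using norm_rv_le[of u i] norm_rv_le[of v j]
  by (intro finite_measure.integrable_const_bound[OF finite_measure_unit, of _
        "(\<Sum>a\<in>set (as i). norm (u a)) * (\<Sum>a\<in>set (as j). norm (v a))"]
      AE_I2 borel_measurable_times measurable_rv)
     (auto simp: abs_mult intro!: mult_mono sum_nonneg)

lemma integral_prod_rv:
  fixes u :: "nat \<Rightarrow> real \<Rightarrow> 'a :: {real_normed_field, banach, second_countable_topology}"
  shows "(\<integral>t. (\<Prod>i<n. u i (rv i t)) \<partial>unit_measure)
    = (\<Prod>i<n. (\<Sum>a\<leftarrow>as i. u i a) / of_nat (length (as i)))"
  unfolding rv_def sum_list_sum_nth using length_pos
  by (subst integral_prod_cantor_digit[of _ "\<lambda>i d. u i (as i ! d)"]) (auto simp: atLeast0LessThan)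

text \<open>The general product formula with all factors other than those at \<open>i\<close> and
  \<open>j\<close> equal to 1.\<close>

lemma integral_rv_mult:
  fixes u v :: "real \<Rightarrow> real"
  assumes "i \<noteq> j"
  shows "(\<integral>t. u (rv i t) * v (rv j t) \<partial>unit_measure) = avg i u * avg j v"
proof -
  define w where "w k = (if k = i then u else if k = j then v else (\<lambda>_. 1))" for k
  define n where "n = Suc (max i j)"
  have "{i, j} \<subseteq> {..<n}" by (auto simp: n_def)
  have eq: "(\<Prod>k<n. g k) = g i * g j" if "\<And>k. k \<noteq> i \<Longrightarrow> k \<noteq> j \<Longrightarrow> g k = 1" for g :: "nat \<Rightarrow> real"
    using prod.mono_neutral_right[OF _ \<open>{i, j} \<subseteq> {..<n}\<close>, of g] that assms by simp
  have "(\<Prod>k<n. w k (rv k t)) = u (rv i t) * v (rv j t)" for t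
    using assms by (subst eq) (auto simp: w_def)
  moreover have "(\<Prod>k<n. (\<Sum>a\<leftarrow>as k. w k a) / of_nat (length (as k))) = avg i u * avg j v"
    using assms nonempty by (subst eq) (auto simp: w_def avg_def sum_list_triv)
  ultimately show ?thesis
    using integral_prod_rv[where n = n and u = w] by simp
qed

lemma integral_rv: "(\<integral>t. u (rv i t) \<partial>unit_measure) = avg i u"
  using integral_rv_mult[of i "Suc i" u "\<lambda>_. 1"] nonempty by (simp add: avg_def sum_list_triv)

lemma avg_mono: "(\<And>a. a \<in> set (as i) \<Longrightarrow> u a \<le> v a) \<Longrightarrow> avg i u \<le> avg i v"
  unfolding avg_def by (intro divide_right_mono sum_list_mono) auto

lemma avg_cmult: "avg i (\<lambda>a. c * u a) = c * avg i u"
  by (simp add: avg_def sum_list_const_mult)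

lemma avg_add: "avg i (\<lambda>a. u a + v a) = avg i u + avg i v"
  by (simp add: avg_def sum_list_addf add_divide_distrib)

lemma avg_const: "avg i (\<lambda>_. c) = c"
  using nonempty by (simp add: avg_def sum_list_triv)

lemma avg_odd: "(\<And>a. u (- a) = - u a) \<Longrightarrow> avg i u = 0"
  by (simp add: avg_def odd_sum)

lemma avg_sum: "avg i (\<lambda>a. \<Sum>k<(K :: nat). u k a) = (\<Sum>k<K. avg i (u k))"
  by (induction K) (auto simp: avg_add avg_const)

definition rv_sum :: "nat \<Rightarrow> (nat \<Rightarrow> real) \<Rightarrow> real \<Rightarrow> real" where
  "rv_sum n x t = (\<Sum>i<n. x i * rv i t)"

lemma integrable_rv_sum: "integrable unit_measure (rv_sum n x)"
  unfolding rv_sum_def using integrable_rv[of "\<lambda>a. x _ * a"] by (intro Bochner_Integration.integrable_sum)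

text \<open>Odd functions have mean 0, so by independence all cross terms vanish.\<close>

lemma integral_square_odd:
  fixes s :: "nat \<Rightarrow> real \<Rightarrow> real"
  assumes "\<And>i a. s i (- a) = - s i a"
  shows "integrable unit_measure (\<lambda>t. (\<Sum>i<n. s i (rv i t))\<^sup>2)"
    and "(\<integral>t. (\<Sum>i<n. s i (rv i t))\<^sup>2 \<partial>unit_measure) = (\<Sum>i<n. avg i (\<lambda>a. (s i a)\<^sup>2))"
proof -
  have eq: "(\<Sum>i<n. s i (rv i t))\<^sup>2 = (\<Sum>i<n. \<Sum>j<n. s i (rv i t) * s j (rv j t))" for t
    by (simp add: power2_eq_square sum_product)
  show "integrable unit_measure (\<lambda>t. (\<Sum>i<n. s i (rv i t))\<^sup>2)"
    unfolding eq by (intro Bochner_Integration.integrable_sum integrable_rv_mult)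
  have "(\<integral>t. (\<Sum>i<n. s i (rv i t))\<^sup>2 \<partial>unit_measure)
      = (\<Sum>i<n. \<Sum>j<n. \<integral>t. s i (rv i t) * s j (rv j t) \<partial>unit_measure)"
    unfolding eq by (simp add: integrable_rv_mult Bochner_Integration.integral_sum)
  also have "\<dots> = (\<Sum>i<n. \<Sum>j<n. if j = i then avg i (\<lambda>a. (s i a)\<^sup>2) else 0)"
  proof (intro sum.cong refl)
    fix i j
    show "(\<integral>t. s i (rv i t) * s j (rv j t) \<partial>unit_measure) = (if j = i then avg i (\<lambda>a. (s i a)\<^sup>2) else 0)"
      using integral_rv[of "\<lambda>a. (s i a)\<^sup>2" i] integral_rv_mult[of i j "s i" "s j"] avg_odd[of "s i", OF assms]
      by (auto simp: power2_eq_square)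
  qed
  finally show "(\<integral>t. (\<Sum>i<n. s i (rv i t))\<^sup>2 \<partial>unit_measure) = (\<Sum>i<n. avg i (\<lambda>a. (s i a)\<^sup>2))"
    by simp
qed

text \<open>Each summand is split at modulus 1 into a bounded odd part \<open>s\<close> and a large
  part dominated by \<open>l\<close>. The bound \<open>\<bar>y\<bar> \<le> (1 + y^2) / 2\<close>
  passes from the first to the second moment of the sum of the \<open>s\<close> parts and leaves the
  additive \<open>1 / 2\<close>.\<close>

lemma integral_abs_rv_sum_le:
  "(\<integral>t. \<bar>rv_sum n x t\<bar> \<partial>unit_measure) \<le> 1 / 2 + (\<Sum>i<n. avg i (\<lambda>a. quad_lin (x i * a)))"
proof -
  define s where "s i a = (if \<bar>x i * a\<bar> \<le> 1 then x i * a else 0)" for i a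
  define l where "l i a = (if \<bar>x i * a\<bar> \<le> 1 then 0 else \<bar>x i * a\<bar>)" for i a
  have split: "(s i a)\<^sup>2 + l i a = quad_lin (x i * a)" for i a
  proof (cases "\<bar>x i * a\<bar> \<le> 1")
    case True
    then have "(x i * a)\<^sup>2 \<le> \<bar>x i * a\<bar>"
      using mult_left_mono[of "\<bar>x i * a\<bar>" 1 "\<bar>x i * a\<bar>"] by (simp add: power2_eq_square)
    with True show ?thesis by (simp add: s_def l_def quad_lin_def)
  next
    case False
    then have "\<bar>x i * a\<bar> \<le> (x i * a)\<^sup>2"
      using mult_left_mono[of 1 "\<bar>x i * a\<bar>" "\<bar>x i * a\<bar>"] by (simp add: power2_eq_square)
    with False show ?thesis by (simp add: s_def l_def quad_lin_def)
  qed
  have odd: "s i (- a) = - s i a" for i a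
    by (simp add: s_def)
  have le: "\<bar>rv_sum n x t\<bar> \<le> (1 + (\<Sum>i<n. s i (rv i t))\<^sup>2) / 2 + (\<Sum>i<n. l i (rv i t))" for t
  proof -
    have "\<bar>rv_sum n x t\<bar> \<le> \<bar>\<Sum>i<n. s i (rv i t)\<bar> + \<bar>\<Sum>i<n. x i * rv i t - s i (rv i t)\<bar>"
      by (simp add: rv_sum_def sum_subtractf)
    also have "\<bar>\<Sum>i<n. x i * rv i t - s i (rv i t)\<bar> \<le> (\<Sum>i<n. l i (rv i t))"
      by (intro order_trans[OF sum_abs] sum_mono) (auto simp: s_def l_def)
    also have "\<bar>\<Sum>i<n. s i (rv i t)\<bar> \<le> (1 + (\<Sum>i<n. s i (rv i t))\<^sup>2) / 2"
      using sum_squares_bound[of 1 "\<bar>\<Sum>i<n. s i (rv i t)\<bar>"] by simp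
    finally show ?thesis by simp
  qed
  interpret finite_measure unit_measure by (rule finite_measure_unit)
  note int = integral_square_odd(1)[of s, OF odd] integrable_rv[of "l _"]
  have "(\<integral>t. \<bar>rv_sum n x t\<bar> \<partial>unit_measure)
      \<le> (\<integral>t. (1 + (\<Sum>i<n. s i (rv i t))\<^sup>2) / 2 + (\<Sum>i<n. l i (rv i t)) \<partial>unit_measure)"
    using le int by (intro integral_mono integrable_abs integrable_rv_sum) auto
  also have "\<dots> = (1 + (\<Sum>i<n. avg i (\<lambda>a. (s i a)\<^sup>2))) / 2 + (\<Sum>i<n. avg i (l i))"
    using int by (simp add: Bochner_Integration.integral_sum integral_rv integral_square_odd(2)[of s, OF odd] measure_unit)
  also have "\<dots> \<le> 1 / 2 + ((\<Sum>i<n. avg i (\<lambda>a. (s i a)\<^sup>2)) + (\<Sum>i<n. avg i (l i)))"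
  proof -
    have "0 \<le> avg i (\<lambda>a. (s i a)\<^sup>2)" for i
      using avg_mono[of i "\<lambda>_. 0"] by (simp add: avg_const)
    then show ?thesis by (simp add: sum_nonneg)
  qed
  also have "\<dots> = 1 / 2 + (\<Sum>i<n. avg i (\<lambda>a. quad_lin (x i * a)))"
    by (simp add: sum.distrib[symmetric] avg_add[symmetric] split)
  finally show ?thesis .
qed

text \<open>The characteristic function of a sum of independent variables factorizes; by symmetry
  the sine parts cancel and each factor is real.\<close>

lemma integral_cos_rv_sum:
  "(\<integral>t. cos (rv_sum n x t) \<partial>unit_measure) = (\<Prod>i<n. avg i (\<lambda>a. cos (x i * a)))"
proof -
  have cis: "cis (rv_sum n x t) = (\<Prod>i<n. cis (x i * rv i t))" for t
    by (simp add: rv_sum_def cis_conv_exp exp_sum sum_distrib_left)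
  interpret finite_measure unit_measure by (rule finite_measure_unit)
  have meas: "(\<lambda>t. cis (rv_sum n x t)) \<in> borel_measurable unit_measure"
    unfolding cis by (intro borel_measurable_prod measurable_rv)
  have int: "integrable unit_measure (\<lambda>t. cis (rv_sum n x t))"
    using meas by (intro integrable_const_bound[of _ 1]) auto
  have avg: "(\<Sum>a\<leftarrow>as i. cis (x i * a)) / of_nat (length (as i)) = of_real (avg i (\<lambda>a. cos (x i * a)))" for i
  proof -
    have "(\<Sum>a\<leftarrow>xs. cis (x i * a)) = Complex (\<Sum>a\<leftarrow>xs. cos (x i * a)) (\<Sum>a\<leftarrow>xs. sin (x i * a))" for xs
      by (induction xs) (auto simp: complex_eq_iff)
    moreover have "(\<Sum>a\<leftarrow>as i. sin (x i * a)) = 0"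
      by (rule odd_sum) simp
    ultimately show ?thesis by (simp add: avg_def complex_of_real_def[symmetric])
  qed
  have "(\<integral>t. cos (rv_sum n x t) \<partial>unit_measure) = Re (\<integral>t. cis (rv_sum n x t) \<partial>unit_measure)"
    using integral_bounded_linear[OF bounded_linear_Re int] by simp
  also have "(\<integral>t. cis (rv_sum n x t) \<partial>unit_measure) = of_real (\<Prod>i<n. avg i (\<lambda>a. cos (x i * a)))"
    unfolding cis integral_prod_rv[of "\<lambda>i a. cis (x i * a)"] avg by simp
  finally show ?thesis by (simp del: of_real_prod)
qed

text \<open>The integral of \<open>lacunary_cos\<close> of the sum is compared with the sum of the
  separate integrals, scale by scale. The constant 15 is 3 from \<open>lacunary_cos_ge\<close> times
  5 from \<open>lacunary_cos_le\<close>.\<close>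

lemma integral_abs_rv_sum_ge:
  fixes n x
  defines "B \<equiv> (\<Sum>i<n. avg i (\<lambda>a. quad_lin (x i * a)))"
  shows "B / (1 + 2 * B) \<le> 15 * (\<integral>t. \<bar>rv_sum n x t\<bar> \<partial>unit_measure)"
proof -
  interpret finite_measure unit_measure by (rule finite_measure_unit)
  have avg_nonneg: "0 \<le> avg i (\<lambda>a. quad_lin (x i * a))" for i
    using avg_mono[of i "\<lambda>_. 0"] by (simp add: avg_const)
  have B: "0 \<le> B" unfolding B_def by (intro sum_nonneg avg_nonneg)
  \<comment> \<open>All values of the summands lie below \<open>2^K\<close>, so one number of scales
    serves them all.\<close>
  obtain K where K: "(\<Sum>i<n. \<Sum>a\<in>set (as i). \<bar>x i * a\<bar>) < 2 ^ K"
    using real_arch_pow[of 2] by auto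
  have small: "\<bar>x i * a\<bar> < 2 ^ Suc K" if "i < n" "a \<in> set (as i)" for i a
  proof -
    have "\<bar>x i * a\<bar> \<le> (\<Sum>a\<in>set (as i). \<bar>x i * a\<bar>)"
      using that by (intro member_le_sum[where f = "\<lambda>a. \<bar>x i * a\<bar>"]) auto
    also have "\<dots> \<le> (\<Sum>i<n. \<Sum>a\<in>set (as i). \<bar>x i * a\<bar>)"
      using that by (intro member_le_sum[where f = "\<lambda>i. \<Sum>a\<in>set (as i). \<bar>x i * a\<bar>"]) (auto intro: sum_nonneg)
    finally show ?thesis using K by (auto intro: less_trans)
  qed
  define p where "p k i = avg i (\<lambda>a. 1 - cos (x i / 2 ^ k * a))" for k i
  have p_eq: "avg i (\<lambda>a. cos (x i / 2 ^ k * a)) = 1 - p k i" for k i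
    using avg_add[of i "\<lambda>a. cos (x i / 2 ^ k * a)" "\<lambda>a. 1 - cos (x i / 2 ^ k * a)"] avg_const[of i 1]
    by (simp add: p_def)
  have p_nonneg: "0 \<le> p k i" for k i
    unfolding p_def using avg_mono[of i "\<lambda>_. 0"] by (simp add: avg_const)
  \<comment> \<open>Here \<open>lazy\<close> is applied to a cosine, which is at least -1 and equals
    1 at 0.\<close>
  have p_le_1: "p k i \<le> 1" for k i
  proof -
    have "0 \<le> avg i (\<lambda>a. cos (x i / 2 ^ k * a))"
      unfolding avg_def by (intro divide_nonneg_nonneg lazy) auto
    then show ?thesis unfolding p_eq by simp
  qed
  \<comment> \<open>The same bound holds at every scale, since dividing the argument by
    \<open>2^k\<close> only decreases \<open>quad_lin\<close>.\<close>
  have p_sum: "(\<Sum>i<n. p k i) \<le> 2 * B" for k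
    unfolding B_def sum_distrib_left
  proof (intro sum_mono)
    fix i
    have "p k i \<le> avg i (\<lambda>a. 2 * quad_lin (x i * a))"
      unfolding p_def
    proof (rule avg_mono)
      fix a
      have "quad_lin (x i / 2 ^ k * a) \<le> quad_lin (x i * a)"
        using mult_left_mono[of 1 "2 ^ k" "\<bar>x i * a\<bar>"]
        by (intro quad_lin_mono) (simp add: abs_mult divide_le_eq mult_ac)
      then show "1 - cos (x i / 2 ^ k * a) \<le> 2 * quad_lin (x i * a)"
        using one_minus_cos_le_quad_lin[of "x i / 2 ^ k * a"] by linarith
    qed
    then show "p k i \<le> 2 * avg i (\<lambda>a. quad_lin (x i * a))"
      by (simp add: avg_cmult)
  qed
  have scale: "cos (rv_sum n x t / 2 ^ k) = cos (rv_sum n (\<lambda>i. x i / 2 ^ k) t)" for t k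
    by (simp add: rv_sum_def sum_divide_distrib)
  have meas: "rv_sum n y \<in> borel_measurable unit_measure" for y
    using integrable_rv_sum by (rule borel_measurable_integrable)
  have int_cos: "integrable unit_measure (\<lambda>t. cos (rv_sum n y t))" for y
    using meas[of y]
    by (intro integrable_const_bound[of _ 1] borel_measurable_continuous_on[of cos] continuous_intros) auto
  have "B / 3 \<le> (\<Sum>i<n. avg i (\<lambda>a. lacunary_cos (Suc K) (x i * a)))"
    unfolding B_def sum_divide_distrib
  proof (rule sum_mono)
    fix i assume "i \<in> {..<n}"
    then have "avg i (\<lambda>a. 1 / 3 * quad_lin (x i * a)) \<le> avg i (\<lambda>a. lacunary_cos (Suc K) (x i * a))"
      using lacunary_cos_ge[OF small] by (intro avg_mono) auto
    then show "avg i (\<lambda>a. quad_lin (x i * a)) / 3 \<le> avg i (\<lambda>a. lacunary_cos (Suc K) (x i * a))"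
      unfolding avg_cmult by simp
  qed
  also have "\<dots> = (\<Sum>i<n. \<Sum>k<Suc K. 2 ^ k * p k i)"
    unfolding lacunary_cos_def avg_sum avg_cmult p_def by simp
  also have "\<dots> = (\<Sum>k<Suc K. 2 ^ k * (\<Sum>i<n. p k i))"
    by (subst sum.swap) (simp only: sum_distrib_left)
  finally have "B / 3 / (1 + 2 * B) \<le> (\<Sum>k<Suc K. 2 ^ k * (\<Sum>i<n. p k i)) / (1 + 2 * B)"
    using B by (intro divide_right_mono) auto
  also have "\<dots> = (\<Sum>k<Suc K. 2 ^ k * ((\<Sum>i<n. p k i) / (1 + 2 * B)))"
    by (subst sum_divide_distrib) (simp only: times_divide_eq_right)
  also have "\<dots> \<le> (\<Sum>k<Suc K. 2 ^ k * (1 - (\<Prod>i<n. 1 - p k i)))"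
    using p_nonneg p_le_1 p_sum by (intro sum_mono mult_left_mono one_minus_prod_ge) auto
  also have "\<dots> = (\<Sum>k<Suc K. 2 ^ k * (1 - (\<integral>t. cos (rv_sum n x t / 2 ^ k) \<partial>unit_measure)))"
    unfolding scale integral_cos_rv_sum p_eq ..
  also have "\<dots> = (\<integral>t. lacunary_cos (Suc K) (rv_sum n x t) \<partial>unit_measure)"
    unfolding lacunary_cos_def scale
    by (subst Bochner_Integration.integral_sum) (use int_cos in \<open>auto simp: measure_unit\<close>)
  also have "\<dots> \<le> (\<integral>t. 5 * \<bar>rv_sum n x t\<bar> \<partial>unit_measure)"
  proof (rule integral_mono)
    show "integrable unit_measure (\<lambda>t. lacunary_cos (Suc K) (rv_sum n x t))"
      unfolding lacunary_cos_def scale using int_cos by (intro Bochner_Integration.integrable_sum) auto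
  qed (use integrable_rv_sum lacunary_cos_le in auto)
  finally have "B / 3 / (1 + 2 * B) \<le> 5 * (\<integral>t. \<bar>rv_sum n x t\<bar> \<partial>unit_measure)"
    by simp
  moreover have "B / 3 / (1 + 2 * B) = B / (1 + 2 * B) / 3"
    by (simp only: divide_divide_eq_left mult.commute)
  ultimately show ?thesis by linarith
qed

end

section \<open>Mixtures of truncations\<close>

text \<open>The factor \<open>min i j\<close> is what matters: nondecreasing concave sequences
  starting at 0 are mixtures of such truncations.\<close>

lemma quad_lin_divide:
  fixes i j :: nat
  assumes "j > 0"
  shows "quad_lin (real i / real j) = real i / (real j)\<^sup>2 * real (min i j)"
proof (cases "i \<le> j")
  case True
  then have "(real i / real j)\<^sup>2 \<le> \<bar>real i / real j\<bar>"
    using assms mult_left_mono[of "real i / real j" 1 "real i / real j"] by (simp add: power2_eq_square)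
  then show ?thesis using True assms by (simp add: quad_lin_def power2_eq_square)
next
  case False
  then have "\<bar>real i / real j\<bar> \<le> (real i / real j)\<^sup>2"
    using assms mult_left_mono[of 1 "real i / real j" "real i / real j"] by (simp add: power2_eq_square)
  then show ?thesis using False assms by (simp add: quad_lin_def power2_eq_square)
qed

text \<open>Abel summation writes \<open>a\<close> as a combination of \<open>min i (j + 1)\<close>
  with the negated second differences as weights. Concavity and the last increment being nonnegative
  make these weights nonnegative.\<close>

lemma concave_sequence_quad_lin_mixture:
  fixes a :: "nat \<Rightarrow> real"
  assumes "n > 0" and "a 0 = 0" and "a (n - 1) \<le> a n"
    and concave: "\<And>j. Suc j < n \<Longrightarrow> a j + a (Suc (Suc j)) \<le> 2 * a (Suc j)"
  obtains w :: "nat \<Rightarrow> real" where "\<And>j. j < n \<Longrightarrow> 0 \<le> w j"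
    and "\<And>i. i \<le> n \<Longrightarrow> (\<Sum>j<n. w j * quad_lin (real i / real (Suc j))) = real i / real n * a i"
proof -
  \<comment> \<open>Setting the increments to 0 from \<open>n\<close> on makes the last weight the
    last increment itself.\<close>
  define e where "e j = (if j < n then a (Suc j) - a j else 0)" for j
  \<comment> \<open>The square cancels the denominator in \<open>quad_lin_divide\<close>.\<close>
  define w where "w j = (real (Suc j))\<^sup>2 / real n * (e j - e (Suc j))" for j
  have e: "e (Suc j) \<le> e j" if "j < n" for j
  proof (cases "Suc j < n")
    case True
    then show ?thesis using concave[of j] by (simp add: e_def)
  next
    case False
    then have "Suc j = n" using that by simp
    then show ?thesis using assms(3) by (auto simp: e_def)
  qed
  have abel: "(\<Sum>j<n. (e j - e (Suc j)) * real (min i (Suc j))) = a i" if "i \<le> n" for i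
    using that
  proof (induction i)
    case 0
    then show ?case by (simp add: assms)
  next
    case (Suc i)
    have "(\<Sum>j<n. (e j - e (Suc j)) * real (min (Suc i) (Suc j)))
        = (\<Sum>j<n. (e j - e (Suc j)) * real (min i (Suc j))) + (\<Sum>j<n. if i \<le> j then e j - e (Suc j) else 0)"
      unfolding sum.distrib[symmetric] by (intro sum.cong) (auto simp: min_def algebra_simps le_Suc_eq)
    also have "(\<Sum>j<n. if i \<le> j then e j - e (Suc j) else 0) = (\<Sum>j=i..<n. e j - e (Suc j))"
      by (intro sum.mono_neutral_cong_right) auto
    also have "\<dots> = e i - e n"
      using Suc.prems sum_Suc_diff'[of i n e] by (simp add: sum_subtractf)
    finally show ?case using Suc by (simp add: e_def)
  qed
  show thesis
  proof
    show "0 \<le> w j" if "j < n" for j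
      using e[OF that] by (simp add: w_def)
    show "(\<Sum>j<n. w j * quad_lin (real i / real (Suc j))) = real i / real n * a i" if "i \<le> n" for i
    proof -
      have "(\<Sum>j<n. w j * quad_lin (real i / real (Suc j)))
          = (\<Sum>j<n. real i / real n * ((e j - e (Suc j)) * real (min i (Suc j))))"
        by (intro sum.cong refl) (simp add: w_def quad_lin_divide del: of_nat_Suc)
      then show ?thesis using abel[OF that] by (simp only: sum_distrib_left[symmetric])
    qed
  qed
qed

section \<open>Functions growing between linearly and quadratically, and their symmetric
  laws\<close>

text \<open>For positive \<open>t\<close> the two growth conditions say that \<open>M t / t\<close>
  is nondecreasing and \<open>M t / t^2\<close> nonincreasing; convexity and 2-concavity enter the
  construction in this form.\<close>

locale growth_1_2 =
  fixes M :: "real \<Rightarrow> real"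
  assumes even: "M (- t) = M t"
    and M_1: "M 1 = 1"
    and growth_lower: "0 \<le> k \<Longrightarrow> k \<le> 1 \<Longrightarrow> k\<^sup>2 * M t \<le> M (k * t)"
    and growth_upper: "0 \<le> k \<Longrightarrow> k \<le> 1 \<Longrightarrow> M (k * t) \<le> k * M t"
begin

lemma M_abs: "M \<bar>t\<bar> = M t"
  by (cases "t \<ge> 0") (auto simp: even)

lemma M_nonneg: "0 \<le> M t"
  using growth_lower[of "1/2" t] growth_upper[of "1/2" t] by (simp add: power_divide)

lemma M_0: "M 0 = 0"
  using growth_upper[of 0 0] M_nonneg[of 0] by simp

lemma M_lower: "0 \<le> s \<Longrightarrow> s \<le> t \<Longrightarrow> 0 < t \<Longrightarrow> (s / t)\<^sup>2 * M t \<le> M s"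
  using growth_lower[of "s / t" t] by simp

lemma M_upper: "0 \<le> s \<Longrightarrow> s \<le> t \<Longrightarrow> 0 < t \<Longrightarrow> M s \<le> (s / t) * M t"
  using growth_upper[of "s / t" t] by simp

lemma M_mono:
  assumes "\<bar>s\<bar> \<le> \<bar>t\<bar>"
  shows "M s \<le> M t"
proof (cases "t = 0")
  case False
  have "M \<bar>s\<bar> \<le> (\<bar>s\<bar> / \<bar>t\<bar>) * M \<bar>t\<bar>"
    using assms False by (intro M_upper) auto
  also have "\<dots> \<le> 1 * M \<bar>t\<bar>"
    using assms False by (intro mult_right_mono M_nonneg) auto
  finally show ?thesis by (simp add: M_abs)
qed (use assms in simp)

lemma M_quarter: "M t \<le> 4 * M (t / 2)"
  using growth_lower[of "1/2" t] by (simp add: power_divide)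

text \<open>An infimum of affine functions of \<open>t\<close>, hence concave; the term \<open>s = t\<close> shows that it exceeds
  \<open>M t / t\<close> at most by a factor \<open>2\<close>.\<close>

definition maj :: "real \<Rightarrow> real" where
  "maj t = (INF s\<in>{0<..}. M s / s + t * (M s / s\<^sup>2))"

lemma maj_term_nonneg: "0 < s \<Longrightarrow> 0 \<le> t \<Longrightarrow> 0 \<le> M s / s + t * (M s / s\<^sup>2)"
  by (simp add: M_nonneg)

lemma maj_le: "0 < s \<Longrightarrow> 0 \<le> t \<Longrightarrow> maj t \<le> M s / s + t * (M s / s\<^sup>2)"
  unfolding maj_def using maj_term_nonneg by (intro cINF_lower bdd_belowI2[of _ 0]) auto

lemma maj_ge: "(\<And>s. 0 < s \<Longrightarrow> c \<le> M s / s + t * (M s / s\<^sup>2)) \<Longrightarrow> c \<le> maj t"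
  unfolding maj_def by (intro cINF_greatest) auto

text \<open>For \<open>s \<ge> t\<close> the first summand of the affine function already dominates
  \<open>M t / t\<close>, because \<open>M t / t\<close> increases; for \<open>s < t\<close> the
  second does, because \<open>M t / t^2\<close> decreases.\<close>

lemma maj_lower:
  assumes "0 < t"
  shows "M t \<le> t * maj t"
proof -
  have "M t / t \<le> maj t"
  proof (rule maj_ge)
    fix s :: real assume "0 < s"
    show "M t / t \<le> M s / s + t * (M s / s\<^sup>2)"
    proof (cases "t \<le> s")
      case True
      have "M t / t \<le> M s / s"
        using M_upper[of t s] True assms by (simp add: field_simps)
      then show ?thesis using assms M_nonneg[of s] by (simp add: add_increasing2)
    next
      case False
      have "M t / t \<le> t * (M s / s\<^sup>2)"
        using M_lower[of s t] False assms \<open>0 < s\<close> by (simp add: field_simps power2_eq_square)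
      then show ?thesis using \<open>0 < s\<close> M_nonneg[of s] by (simp add: add_increasing)
    qed
  qed
  then show ?thesis using assms by (simp add: field_simps)
qed

lemma maj_upper: "0 < t \<Longrightarrow> t * maj t \<le> 2 * M t"
  using mult_left_mono[OF maj_le[of t t], of t] by (simp add: field_simps power2_eq_square)

lemma maj_nonneg: "0 \<le> t \<Longrightarrow> 0 \<le> maj t"
  using maj_term_nonneg by (intro maj_ge)

lemma maj_mono:
  assumes "0 \<le> a" "a \<le> b"
  shows "maj a \<le> maj b"
proof (rule maj_ge)
  fix s :: real assume "0 < s"
  have "maj a \<le> M s / s + a * (M s / s\<^sup>2)"
    using \<open>0 < s\<close> assms by (intro maj_le)
  also have "\<dots> \<le> M s / s + b * (M s / s\<^sup>2)"
    using assms by (intro add_left_mono mult_right_mono) (auto simp: M_nonneg)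
  finally show "maj a \<le> \<dots>" .
qed

lemma maj_concave:
  assumes "0 \<le> a" "0 \<le> b"
  shows "maj a + maj b \<le> 2 * maj ((a + b) / 2)"
proof -
  have "(maj a + maj b) / 2 \<le> maj ((a + b) / 2)"
  proof (rule maj_ge)
    fix s :: real assume "0 < s"
    then show "(maj a + maj b) / 2 \<le> M s / s + (a + b) / 2 * (M s / s\<^sup>2)"
      using maj_le[of s a] maj_le[of s b] assms by (simp add: algebra_simps add_divide_distrib)
  qed
  then show ?thesis by simp
qed

text \<open>At grid points the mixture is \<open>t * maj t\<close>, between \<open>M t\<close> and
  \<open>2 * M t\<close>. Neighbouring positive grid points differ at most by a factor 2, hence
  their \<open>M\<close> values by a factor 4, which gives \<open>1 / 4\<close> and 8. The additive
  errors come from the cell next to 0, where \<open>M \<le> 1 / n\<close>.\<close>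

lemma grid_mixture:
  assumes "n > 0"
  obtains w :: "nat \<Rightarrow> real" where "\<And>j. j < n \<Longrightarrow> 0 \<le> w j" and "(\<Sum>j<n. w j) \<le> 2"
    and "\<And>t. 0 \<le> t \<Longrightarrow> t \<le> 1 \<Longrightarrow>
      M t / 4 - 1 / real n \<le> (\<Sum>j<n. w j * quad_lin (t * (real n / real (Suc j))))"
    and "\<And>t. 0 \<le> t \<Longrightarrow> t \<le> 1 \<Longrightarrow>
      (\<Sum>j<n. w j * quad_lin (t * (real n / real (Suc j)))) \<le> 8 * M t + 2 / real n"
proof -
  \<comment> \<open>\<open>maj 0\<close> may be positive, as for \<open>M t = \<bar>t\<bar>\<close>.
    Lowering the left end to 0 preserves concavity, and the value there is multiplied by 0
    anyway.\<close>
  define a where "a j = (if j = 0 then 0 else maj (real j / real n))" for j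
  have "a (n - 1) \<le> a n"
    unfolding a_def using assms by (auto intro!: maj_mono maj_nonneg divide_right_mono)
  moreover have "a j + a (Suc (Suc j)) \<le> 2 * a (Suc j)" for j
  proof -
    have "a j + a (Suc (Suc j)) \<le> maj (real j / real n) + maj (real (Suc (Suc j)) / real n)"
      unfolding a_def by (auto simp: maj_nonneg)
    also have "\<dots> \<le> 2 * maj ((real j / real n + real (Suc (Suc j)) / real n) / 2)"
      by (rule maj_concave) auto
    also have "(real j / real n + real (Suc (Suc j)) / real n) / 2 = real (Suc j) / real n"
      by (simp add: add_divide_distrib)
    finally show ?thesis by (simp add: a_def)
  qed
  ultimately obtain w where w: "\<And>j. j < n \<Longrightarrow> 0 \<le> w j"
    and w_sum: "\<And>i. i \<le> n \<Longrightarrow> (\<Sum>j<n. w j * quad_lin (real i / real (Suc j))) = real i / real n * a i"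
    using concave_sequence_quad_lin_mixture[of n a] assms by (auto simp: a_def)
  define F where "F t = (\<Sum>j<n. w j * quad_lin (t * (real n / real (Suc j))))" for t
  have F_grid: "F (real i / real n) = real i / real n * a i" if "i \<le> n" for i
    using w_sum[OF that] assms by (simp add: F_def)
  have F_lower: "M (real i / real n) \<le> F (real i / real n)" 
    and F_upper: "F (real i / real n) \<le> 2 * M (real i / real n)" if "i \<le> n" for i
    using maj_lower[of "real i / real n"] maj_upper[of "real i / real n"] assms
    unfolding F_grid[OF that] a_def by (auto simp: M_0)
  have F_mono: "F s \<le> F t" if "0 \<le> s" "s \<le> t" for s t
    unfolding F_def using w that
    by (intro sum_mono mult_left_mono quad_lin_mono) (auto simp: abs_mult intro!: mult_right_mono divide_right_mono)
  \<comment> \<open>At \<open>t = 1\<close> every truncation in the mixture is at least 1, so the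
    total weight is at most the value of the mixture there.\<close>
  have "(\<Sum>j<n. w j) \<le> F (real n / real n)"
    unfolding F_def
  proof (rule sum_mono)
    fix j assume j: "j \<in> {..<n}"
    have "quad_lin 1 \<le> quad_lin (real n / real (Suc j))"
      using j by (intro quad_lin_mono) (auto simp: field_simps)
    then show "w j \<le> w j * quad_lin (real n / real n * (real n / real (Suc j)))"
      using w[of j] j assms mult_left_mono[of 1 "quad_lin (real n / real (Suc j))" "w j"]
      by (simp add: quad_lin_def[of 1])
  qed
  also have "\<dots> \<le> 2"
    using F_upper[of n] assms M_1 by simp
  finally have w_le: "(\<Sum>j<n. w j) \<le> 2" .
  have "M t / 4 - 1 / real n \<le> F t \<and> F t \<le> 8 * M t + 2 / real n" if t: "0 \<le> t" "t \<le> 1" for t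
  proof -
    define i where "i = nat \<lfloor>real n * t\<rfloor>"
    have i: "real i \<le> real n * t" "real n * t < real i + 1"
      using t by (auto simp: i_def)
    then have i': "real i / real n \<le> t" "t \<le> real (Suc i) / real n"
      using assms by (auto simp: field_simps)
    have "real i \<le> real n"
      using i(1) t assms by (metis mult.commute mult_left_le_one_le of_nat_0_le_iff order_trans)
    then have "i \<le> n" by simp
    have half: "M (real (Suc i) / real n) \<le> 4 * M (real i / real n)" if "i \<noteq> 0"
    proof -
      have "M (real (Suc i) / real n / 2) \<le> M (real i / real n)"
        using that assms by (intro M_mono) (auto simp: field_simps)
      then show ?thesis using M_quarter[of "real (Suc i) / real n"] by simp
    qed
    have first: "M (1 / real n) \<le> 1 / real n"
      using M_upper[of "1 / real n" 1] assms M_1 by simp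
    have M_t: "M (real i / real n) \<le> M t" "M t \<le> M (real (Suc i) / real n)"
      using i' t by (auto intro!: M_mono)
    have "M t / 4 - 1 / real n \<le> F (real i / real n)"
    proof (cases "i = 0")
      case True
      have "F (real i / real n) = 0" using True by (simp add: F_def)
      then show ?thesis using M_t first True M_nonneg[of t] by simp
    next
      case False
      have "0 \<le> 1 / real n" by simp
      then show ?thesis using F_lower[OF \<open>i \<le> n\<close>] half[OF False] M_t by linarith
    qed
    also have "\<dots> \<le> F t" using i' by (intro F_mono) auto
    finally have lower: "M t / 4 - 1 / real n \<le> F t" .
    have "F t \<le> 8 * M t + 2 / real n"
    proof (cases "i = n")
      case True
      then have "t = 1" using i'(1) t assms by simp
      then have "F t \<le> 2" "M t = 1"
        using F_upper[of n] assms M_1 by auto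
      moreover have "0 \<le> 2 / real n" by simp
      ultimately show ?thesis by linarith
    next
      case False
      then have "Suc i \<le> n" using \<open>i \<le> n\<close> by simp
      have "F t \<le> 2 * M (real (Suc i) / real n)"
        using F_mono[of t "real (Suc i) / real n"] i' t F_upper[OF \<open>Suc i \<le> n\<close>] by linarith
      also have "\<dots> \<le> 8 * M t + 2 / real n"
      proof (cases "i = 0")
        case True
        then show ?thesis using first M_nonneg[of t] by simp
      next
        case False
        have "0 \<le> 2 / real n" by simp
        then show ?thesis using half[OF False] M_t by linarith
      qed
      finally show ?thesis .
    qed
    with lower show ?thesis by simp
  qed
  then show thesis using w w_le that[of w] unfolding F_def by blast
qed

text \<open>The weights of a grid mixture are halved to have total at most 1 and rounded down to
  multiples of \<open>1 / m\<close>. The resulting list averages to about a quarter of the mixture,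
  so \<open>1 / 4\<close> and 8 become \<open>1 / 16\<close> and 2.\<close>

lemma symmetric_law:
  assumes "\<epsilon> > 0"
  obtains as :: "real list" where "as \<noteq> []"
    and "\<And>u :: real \<Rightarrow> real. (\<And>a. u (- a) = - u a) \<Longrightarrow> (\<Sum>a\<leftarrow>as. u a) = 0"
    and "\<And>u :: real \<Rightarrow> real. (\<And>a. - 1 \<le> u a) \<Longrightarrow> u 0 = 1 \<Longrightarrow> 0 \<le> (\<Sum>a\<leftarrow>as. u a)"
    and "\<And>t. \<bar>t\<bar> \<le> 1 \<Longrightarrow> M t / 16 - \<epsilon> \<le> (\<Sum>a\<leftarrow>as. quad_lin (t * a)) / real (length as)"
    and "\<And>t. \<bar>t\<bar> \<le> 1 \<Longrightarrow> (\<Sum>a\<leftarrow>as. quad_lin (t * a)) / real (length as) \<le> 2 * M t + \<epsilon>"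
proof -
  obtain n :: nat where "real n > 1 / \<epsilon>"
    using reals_Archimedean2 by blast
  moreover from this have "n > 0"
    using assms by (auto intro!: gr0I dest: less_trans[of 0 "1 / \<epsilon>"])
  ultimately have n: "n > 0" "1 / real n < \<epsilon>"
    using assms by (auto simp: field_simps pos_divide_less_eq mult_less_0_iff intro!: gr0I)
  obtain m :: nat where "real m > (real n)\<^sup>2 / \<epsilon>"
    using reals_Archimedean2 by blast
  moreover from this have "m > 0"
    using assms n(1) by (auto intro!: gr0I simp: divide_less_0_iff)
  ultimately have m: "m > 0" "(real n)\<^sup>2 / real m < \<epsilon>"
    using assms by (auto simp: field_simps)
  obtain w where w: "\<And>j. j < n \<Longrightarrow> 0 \<le> w j" "(\<Sum>j<n. w j) \<le> 2"
    and w_lower: "\<And>t. 0 \<le> t \<Longrightarrow> t \<le> 1 \<Longrightarrow>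
      M t / 4 - 1 / real n \<le> (\<Sum>j<n. w j * quad_lin (t * (real n / real (Suc j))))"
    and w_upper: "\<And>t. 0 \<le> t \<Longrightarrow> t \<le> 1 \<Longrightarrow>
      (\<Sum>j<n. w j * quad_lin (t * (real n / real (Suc j)))) \<le> 8 * M t + 2 / real n"
    using grid_mixture[OF n(1)] by blast
  define q where "q j = nat \<lfloor>real m * w j / 2\<rfloor>" for j
  have q: "real (q j) \<le> real m * w j / 2" "real m * w j / 2 - 1 \<le> real (q j)" if "j < n" for j
    unfolding q_def using w(1)[OF that] of_nat_floor[of "real m * w j / 2"] by (simp, linarith)
  have "(\<Sum>j<n. real (q j)) \<le> (\<Sum>j<n. real m * w j / 2)"
    using q by (intro sum_mono) auto
  also have "\<dots> \<le> real m"
    using w(2) mult_left_mono[of "\<Sum>j<n. w j" 2 "real m / 2"] by (simp add: sum_distrib_left)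
  finally have q_sum: "(\<Sum>j<n. q j) \<le> m"
    by (simp flip: of_nat_sum)
  define cs where "cs = concat (map (\<lambda>j. replicate (q j) (real n / real (Suc j))) [0..<n])"
  have sum_cs: "(\<Sum>a\<leftarrow>cs. u a) = (\<Sum>j<n. real (q j) * u (real n / real (Suc j)))" for u :: "real \<Rightarrow> real"
  proof -
    have "(\<Sum>a\<leftarrow>concat (map (\<lambda>j. replicate (q j) (b j)) [0..<N]). u a) = (\<Sum>j<N. real (q j) * u (b j))"
      for N and b :: "nat \<Rightarrow> real"
      by (induction N) (simp_all add: sum_list_replicate)
    then show ?thesis unfolding cs_def .
  qed
  have len_cs: "length cs \<le> m"
    using q_sum by (simp add: cs_def length_concat comp_def interv_sum_list_conv_sum_set_nat atLeast0LessThan)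
  \<comment> \<open>At most \<open>2 * m\<close> entries are nonzero, so at least half of the
    \<open>4 * m\<close> entries are 0; adjoining the negatives gives symmetry.\<close>
  define as where "as = cs @ map uminus cs @ replicate (4 * m - 2 * length cs) 0"
  have len: "length as = 4 * m"
    using len_cs by (simp add: as_def)
  have sum_as: "(\<Sum>a\<leftarrow>as. u a) = (\<Sum>a\<leftarrow>cs. u a) + (\<Sum>a\<leftarrow>cs. u (- a)) + (4 * real m - 2 * real (length cs)) * u 0"
    for u :: "real \<Rightarrow> real"
    using len_cs by (simp add: as_def sum_list_replicate comp_def of_nat_diff)
  define Q where "Q t = (\<Sum>j<n. real (q j) * quad_lin (t * (real n / real (Suc j))))" for t
  have avg: "(\<Sum>a\<leftarrow>as. quad_lin (t * a)) / real (length as) = Q t / (2 * real m)" for t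
    unfolding sum_as len using sum_cs[of "\<lambda>a. quad_lin (t * a)"] m by (simp add: Q_def)
  have bounds: "M t / 16 - \<epsilon> \<le> Q t / (2 * real m) \<and> Q t / (2 * real m) \<le> 2 * M t + \<epsilon>"
    if t: "0 \<le> t" "t \<le> 1" for t
  proof -
    define F where "F = (\<Sum>j<n. w j * quad_lin (t * (real n / real (Suc j))))"
    have "Q t \<le> (\<Sum>j<n. real m * w j / 2 * quad_lin (t * (real n / real (Suc j))))"
      unfolding Q_def using q by (intro sum_mono mult_right_mono) auto
    also have "\<dots> = real m / 2 * F"
      by (simp add: F_def sum_distrib_left mult_ac)
    finally have Q_upper: "Q t \<le> real m / 2 * F" .
    \<comment> \<open>Rounding loses at most 1 in each of the \<open>n\<close> multiplicities, and
      every truncation is at most \<open>n\<close> here; hence the total error \<open>n^2\<close>,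
      which the choice of \<open>m\<close> makes negligible.\<close>
    have "real m / 2 * F - (real n)\<^sup>2
        = (\<Sum>j<n. real m * w j / 2 * quad_lin (t * (real n / real (Suc j))) - real n)"
      by (simp add: F_def sum_distrib_left mult_ac sum_subtractf power2_eq_square)
    also have "\<dots> \<le> Q t"
      unfolding Q_def
    proof (rule sum_mono)
      fix j assume j: "j \<in> {..<n}"
      let ?x = "quad_lin (t * (real n / real (Suc j)))"
      have "?x \<le> t * (real n / real (Suc j))"
        using quad_lin_le_abs[of "t * (real n / real (Suc j))"] t by simp
      also have "\<dots> \<le> 1 * (real n / 1)"
        using t by (intro mult_mono divide_left_mono) auto
      finally have x: "?x \<le> real n" by simp
      have "(real m * w j / 2 - real (q j)) * ?x \<le> 1 * ?x"
        using q(2)[of j] j by (intro mult_right_mono) auto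
      with x show "real m * w j / 2 * ?x - real n \<le> real (q j) * ?x"
        by (simp add: left_diff_distrib)
    qed
    finally have Q_lower: "real m / 2 * F - (real n)\<^sup>2 \<le> Q t" .
    have "F / 4 - (real n)\<^sup>2 / real m / 2 \<le> Q t / (2 * real m)"
      using divide_right_mono[OF Q_lower, of "2 * real m"] m(1) by (simp add: diff_divide_distrib)
    moreover have "Q t / (2 * real m) \<le> F / 4"
      using divide_right_mono[OF Q_upper, of "2 * real m"] m(1) by simp
    moreover have "M t / 4 - 1 / real n \<le> F" "F \<le> 8 * M t + 2 / real n"
      using w_lower[OF t] w_upper[OF t] by (auto simp: F_def)
    moreover have "2 / real n = 2 * (1 / real n)" by simp
    moreover have "M' / 16 - \<epsilon> \<le> q' \<and> q' \<le> 2 * M' + \<epsilon>"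
      if "F' / 4 - r / 2 \<le> q'" "q' \<le> F' / 4" "M' / 4 - d \<le> F'" "F' \<le> 8 * M' + d'" "d' = 2 * d"
        "d < \<epsilon>" "r < \<epsilon>" for F' r q' M' d d' :: real
      using that assms by (intro conjI; linarith)
    ultimately show ?thesis
      using n(2) m(2) by blast
  qed
  have even_Q: "Q t = Q \<bar>t\<bar>" for t
    by (cases "t \<ge> 0") (auto simp: Q_def)
  show thesis
  proof
    show "as \<noteq> []" using len m by auto
    show "(\<Sum>a\<leftarrow>as. u a) = 0" if "\<And>a. u (- a) = - u a" for u :: "real \<Rightarrow> real"
    proof -
      have "u 0 = 0" using that[of 0] by simp
      moreover have "(\<Sum>a\<leftarrow>cs. u (- a)) = - (\<Sum>a\<leftarrow>cs. u a)"
        unfolding that by (induction cs) auto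
      ultimately show ?thesis by (simp add: sum_as)
    qed
    show "0 \<le> (\<Sum>a\<leftarrow>as. u a)" if u: "\<And>a. - 1 \<le> u a" "u 0 = 1" for u :: "real \<Rightarrow> real"
    proof -
      have "- real (length cs) \<le> (\<Sum>a\<leftarrow>cs. v a)" if "\<And>a. - 1 \<le> v a" for v :: "real \<Rightarrow> real"
        using that by (induction cs) (simp_all, smt (verit))
      from this[of u] this[of "\<lambda>a. u (- a)"] show ?thesis
        using u len_cs by (simp add: sum_as)
    qed
    fix t :: real assume "\<bar>t\<bar> \<le> 1"
    with bounds[of "\<bar>t\<bar>"]
    show "M t / 16 - \<epsilon> \<le> (\<Sum>a\<leftarrow>as. quad_lin (t * a)) / real (length as)"
      "(\<Sum>a\<leftarrow>as. quad_lin (t * a)) / real (length as) \<le> 2 * M t + \<epsilon>"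
      unfolding avg using even_Q[of t] by (auto simp: M_abs)
  qed
qed

end

section \<open>The Orlicz norm\<close>

lemma orlicz_function_growth_upper:
  assumes "orlicz_function M" "0 \<le> k" "k \<le> 1"
  shows "M (k * t) \<le> k * M t"
proof -
  have "convex_on UNIV M" "M 0 = 0" using assms(1) by (auto simp: orlicz_function_def)
  then show ?thesis
    using convex_onD[of UNIV M k 0 t] assms by simp
qed

text \<open>The graph of \<open>M (sqrt r)\<close> lies above its chord from 0 to
  \<open>t^2\<close>; evaluate at \<open>k^2 * t^2\<close>.\<close>

lemma two_concave_growth_lower:
  assumes "orlicz_function M" "two_concave M" "0 \<le> k" "k \<le> 1"
  shows "k\<^sup>2 * M t \<le> M (k * t)"
proof -
  have M: "M (- s) = M s" "M 0 = 0" for s using assms(1) by (auto simp: orlicz_function_def)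
  have M_abs: "M \<bar>s\<bar> = M s" for s by (cases "s \<ge> 0") (auto simp: M)
  have "concave_on {0..} (\<lambda>t. M (sqrt t))" using assms(2) by (simp add: two_concave_def)
  then have "(1 - k\<^sup>2) * M (sqrt 0) + k\<^sup>2 * M (sqrt (t\<^sup>2)) \<le> M (sqrt ((1 - k\<^sup>2) *\<^sub>R 0 + k\<^sup>2 *\<^sub>R t\<^sup>2))"
    using assms by (intro concave_onD) (auto simp: power_le_one)
  moreover have "sqrt (k\<^sup>2 * t\<^sup>2) = \<bar>k * t\<bar>"
    by (simp add: real_sqrt_mult abs_mult)
  ultimately show ?thesis using M by (simp add: M_abs)
qed

lemma orlicz_function_nonneg: "orlicz_function M \<Longrightarrow> 0 \<le> M t"
  by (cases "t = 0") (auto simp: orlicz_function_def less_imp_le)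

lemma orlicz_dual_nonneg:
  assumes "orlicz_function M"
  shows "0 \<le> orlicz_dual M t"
proof -
  have "ereal (0 * t - M 0) \<le> orlicz_dual M t"
    unfolding orlicz_dual_def by (rule SUP_upper) simp
  then show ?thesis using assms by (simp add: orlicz_function_def zero_ereal_def)
qed

lemma young: "ereal (s * t) \<le> ereal (M s) + orlicz_dual M t"
proof -
  have "ereal (s * t - M s) \<le> orlicz_dual M t"
    unfolding orlicz_dual_def by (rule SUP_upper) simp
  then have "ereal (M s) + ereal (s * t - M s) \<le> ereal (M s) + orlicz_dual M t"
    by (rule add_left_mono)
  then show ?thesis by simp
qed

text \<open>\<open>M a / a\<close> takes the role of the derivative of \<open>M\<close> at \<open>a\<close>; it needs no differentiability and
  gives the value \<open>0\<close> at \<open>a = 0\<close>.\<close>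

lemma orlicz_dual_quotient_le:
  assumes "orlicz_function M" "1 \<le> s"
  shows "orlicz_dual M (M a / a / s) \<le> ereal (M a / s)"
  unfolding orlicz_dual_def
proof (rule SUP_least)
  fix r
  have nonneg: "0 \<le> M r" for r using assms(1) by (rule orlicz_function_nonneg)
  have M: "M (- r) = M r" "M 0 = 0" for r using assms(1) by (auto simp: orlicz_function_def)
  have M_abs: "M \<bar>s\<bar> = M s" for s by (cases "s \<ge> 0") (auto simp: M)
  \<comment> \<open>For \<open>\<bar>r\<bar> \<le> \<bar>a\<bar>\<close> the linear term alone is at
    most \<open>M a / s\<close>. For larger \<open>r\<close>, monotonicity of \<open>M r / r\<close>
    makes the difference nonpositive.\<close>
  have "\<bar>r\<bar> * (M a / \<bar>a\<bar> / s) - M r \<le> M a / s"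
  proof (cases "a = 0")
    case True
    then show ?thesis using M nonneg[of r] by simp
  next
    case False
    show ?thesis
    proof (cases "\<bar>r\<bar> \<le> \<bar>a\<bar>")
      case True
      have "\<bar>r\<bar> / \<bar>a\<bar> * (M a / s) \<le> 1 * (M a / s)"
        using True False nonneg[of a] assms(2) by (intro mult_right_mono) auto
      then show ?thesis using nonneg[of r] by simp
    next
      case ra: False
      have "M (\<bar>a\<bar> / \<bar>r\<bar> * \<bar>r\<bar>) \<le> \<bar>a\<bar> / \<bar>r\<bar> * M \<bar>r\<bar>"
        using ra by (intro orlicz_function_growth_upper assms(1)) auto
      then have "M a * \<bar>r\<bar> \<le> \<bar>a\<bar> * M r"
        using ra by (auto simp: M_abs field_simps)
      then have "\<bar>r\<bar> * (M a / \<bar>a\<bar>) \<le> M r"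
        using False by (simp add: field_simps)
      moreover have "\<bar>r\<bar> * (M a / \<bar>a\<bar>) / s \<le> \<bar>r\<bar> * (M a / \<bar>a\<bar>) / 1"
        using nonneg[of a] assms(2) by (intro divide_left_mono) auto
      ultimately have "\<bar>r\<bar> * (M a / \<bar>a\<bar> / s) \<le> M r" by simp
      moreover have "0 \<le> M a / s" using nonneg[of a] assms(2) by simp
      ultimately show ?thesis by linarith
    qed
  qed
  moreover have "r * (M a / a / s) \<le> \<bar>r\<bar> * (M a / \<bar>a\<bar> / s)"
  proof -
    have "r * (M a / a / s) \<le> \<bar>r * (M a / a / s)\<bar>" by (rule abs_ge_self)
    also have "\<dots> = \<bar>r\<bar> * (M a / \<bar>a\<bar> / s)"
      using nonneg[of a] assms(2) by (simp add: abs_mult)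
    finally show ?thesis .
  qed
  ultimately show "ereal (r * (M a / a / s) - M r) \<le> ereal (M a / s)" by simp
qed

lemma orlicz_dual_0: "orlicz_function M \<Longrightarrow> orlicz_dual M 0 = 0"
  using orlicz_dual_quotient_le[of M 1 0] orlicz_dual_nonneg[of M 0]
  by (simp add: orlicz_function_def zero_ereal_def antisym)

lemma orlicz_enorm_nonneg:
  assumes "orlicz_function M"
  shows "0 \<le> orlicz_enorm M x"
proof -
  have "ereal (\<Sum>i. x i * (\<lambda>_. 0) i) \<le> orlicz_enorm M x"
    unfolding orlicz_enorm_def using orlicz_dual_0[OF assms] by (intro SUP_upper) auto
  then show ?thesis by (simp add: zero_ereal_def)
qed

text \<open>Young's inequality for \<open>\<theta> * x i\<close> and \<open>y i\<close>, summed,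
  bounds \<open>\<theta>\<close> times the pairing by \<open>1 + 1\<close>. With
  \<open>orlicz_enorm_ge\<close> this compares the Orlicz norm with the Luxemburg norm up to a
  factor 2.\<close>

lemma orlicz_enorm_le:
  assumes "orlicz_function M" and "\<theta> > 0"
    and sum_le: "\<And>n. (\<Sum>i<n. M (\<theta> * x i)) \<le> 1"
  shows "orlicz_enorm M x \<le> ereal (2 / \<theta>)"
  unfolding orlicz_enorm_def
proof (rule SUP_least)
  fix y assume "y \<in> {y. (\<Sum>i. orlicz_dual M (y i)) \<le> 1 \<and> summable (\<lambda>i. x i * y i)}"
  then have y: "(\<Sum>i. orlicz_dual M (y i)) \<le> 1" and summable: "summable (\<lambda>i. x i * y i)" by auto
  have "(\<Sum>i. x i * y i) \<le> 2 / \<theta>"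
  proof (rule suminf_le_const[OF summable])
    fix n
    have "ereal (\<theta> * (\<Sum>i<n. x i * y i)) = (\<Sum>i<n. ereal (\<theta> * x i * y i))"
      by (simp add: sum_distrib_left mult.assoc)
    also have "\<dots> \<le> (\<Sum>i<n. ereal (M (\<theta> * x i)) + orlicz_dual M (y i))"
      by (intro sum_mono young)
    also have "\<dots> = ereal (\<Sum>i<n. M (\<theta> * x i)) + (\<Sum>i<n. orlicz_dual M (y i))"
      by (simp add: sum.distrib)
    also have "\<dots> \<le> ereal 1 + 1"
    proof (rule add_mono)
      have "(\<Sum>i<n. orlicz_dual M (y i)) \<le> (\<Sum>i. orlicz_dual M (y i))"
        using orlicz_dual_nonneg[OF assms(1)] by (intro suminf_upper) auto
      then show "(\<Sum>i<n. orlicz_dual M (y i)) \<le> 1" using y by (rule order_trans)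
    qed (use sum_le in simp)
    also have "\<dots> = ereal 2" by (simp add: one_ereal_def)
    finally show "(\<Sum>i<n. x i * y i) \<le> 2 / \<theta>"
      using assms(2) by (simp add: field_simps)
  qed
  then show "ereal (\<Sum>i. x i * y i) \<le> ereal (2 / \<theta>)" by simp
qed

lemma orlicz_enorm_ge:
  assumes "orlicz_function M" and "\<theta> > 0"
    and sum_ge: "1 \<le> (\<Sum>i<n. M (\<theta> * x i))"
  shows "ereal (1 / \<theta>) \<le> orlicz_enorm M x"
proof -
  define s where "s = (\<Sum>i<n. M (\<theta> * x i))"
  \<comment> \<open>The test sequence is nearly extremal in Young's inequality; dividing by
    \<open>s\<close> makes it admissible, and its pairing with \<open>x\<close> is exactly
    \<open>1 / \<theta>\<close>. Where \<open>x i = 0\<close>, division by zero gives the entry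
    0.\<close>
  define y where "y i = (if i < n then M (\<theta> * x i) / (\<theta> * x i) / s else 0)" for i
  have s: "1 \<le> s" using sum_ge by (simp add: s_def)
  have "(\<Sum>i. orlicz_dual M (y i)) = (\<Sum>i<n. orlicz_dual M (y i))"
    using orlicz_dual_0[OF assms(1)] by (intro suminf_finite) (auto simp: y_def)
  also have "\<dots> \<le> (\<Sum>i<n. ereal (M (\<theta> * x i) / s))"
    using orlicz_dual_quotient_le[OF assms(1) s] by (intro sum_mono) (auto simp: y_def)
  also have "\<dots> = 1"
    using s by (simp add: sum_divide_distrib[symmetric] s_def[symmetric] one_ereal_def)
  finally have y: "(\<Sum>i. orlicz_dual M (y i)) \<le> 1" .
  have "(\<lambda>i. x i * y i) sums (\<Sum>i<n. x i * y i)"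
    by (rule sums_finite) (auto simp: y_def)
  moreover have "(\<Sum>i<n. x i * y i) = 1 / \<theta>"
  proof -
    have "M 0 = 0" using assms(1) by (simp add: orlicz_function_def)
    then have "(\<Sum>i<n. x i * y i) = (\<Sum>i<n. M (\<theta> * x i) / (\<theta> * s))"
      using assms(2) by (intro sum.cong) (auto simp: y_def)
    also have "\<dots> = s / (\<theta> * s)"
      by (simp add: s_def sum_divide_distrib)
    finally show ?thesis using s by simp
  qed
  ultimately have "summable (\<lambda>i. x i * y i)" "(\<Sum>i. x i * y i) = 1 / \<theta>"
    by (auto simp: sums_iff)
  with y show ?thesis
    unfolding orlicz_enorm_def by (intro SUP_upper2[of y]) auto
qed

lemma orlicz_space_enorm:
  assumes "orlicz_function M" "x \<in> orlicz_space M"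
  shows "orlicz_enorm M x = ereal (orlicz_norm M x)" and "0 \<le> orlicz_norm M x"
proof -
  have "\<bar>orlicz_enorm M x\<bar> \<noteq> \<infinity>"
    using assms orlicz_enorm_nonneg[OF assms(1), of x] by (auto simp: orlicz_space_def)
  then show eq: "orlicz_enorm M x = ereal (orlicz_norm M x)"
    by (simp add: orlicz_norm_def ereal_real)
  then show "0 \<le> orlicz_norm M x"
    using orlicz_enorm_nonneg[OF assms(1), of x] by simp
qed

lemma orlicz_norm_le:
  assumes "orlicz_function M" "x \<in> orlicz_space M" "\<theta> > 0" "\<And>n. (\<Sum>i<n. M (\<theta> * x i)) \<le> 1"
  shows "orlicz_norm M x \<le> 2 / \<theta>"
  using orlicz_enorm_le[OF assms(1,3,4)] orlicz_space_enorm[OF assms(1,2)] by simp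

lemma sum_le_1_of_orlicz_norm:
  assumes "orlicz_function M" "x \<in> orlicz_space M" "\<theta> > 0" "orlicz_norm M x < 1 / \<theta>"
  shows "(\<Sum>i<n. M (\<theta> * x i)) \<le> 1"
proof (rule ccontr)
  assume "\<not> ?thesis"
  then have "ereal (1 / \<theta>) \<le> orlicz_enorm M x"
    using orlicz_enorm_ge[OF assms(1,3), of x n] by simp
  with assms(4) show False
    using orlicz_space_enorm(1)[OF assms(1,2)] by simp
qed

section \<open>The embedding\<close>

text \<open>Keeps coefficients of modular at most 1 inside the interval on which the laws imitate
  \<open>M\<close>.\<close>

lemma (in growth_1_2) M_le_1_imp: "M t \<le> 1 \<Longrightarrow> \<bar>t\<bar> \<le> 1"
proof (rule ccontr)
  assume "M t \<le> 1" "\<not> \<bar>t\<bar> \<le> 1"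
  then have "M 1 \<le> 1 / \<bar>t\<bar> * M \<bar>t\<bar>" by (intro M_upper) auto
  then have "\<bar>t\<bar> \<le> M t"
    using \<open>\<not> \<bar>t\<bar> \<le> 1\<close> M_1 by (simp add: M_abs field_simps)
  with \<open>M t \<le> 1\<close> \<open>\<not> \<bar>t\<bar> \<le> 1\<close> show False by linarith
qed

text \<open>A comparison, on finite sums, of the mean of the modulus with the Luxemburg norm,
  expressed through the modular at every scale \<open>\<theta>\<close>.\<close>

definition models_orlicz :: "(real \<Rightarrow> real) \<Rightarrow> real \<Rightarrow> (nat \<Rightarrow> real \<Rightarrow> real) \<Rightarrow> bool" where
  "models_orlicz M C f \<longleftrightarrow>
     (\<forall>n x. integrable (lebesgue_on {0..1}) (\<lambda>t. \<Sum>i<n. x i * f i t)) \<and>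
     (\<forall>\<theta> n x. 0 < \<theta> \<longrightarrow> (\<Sum>i<n. M (\<theta> * x i)) \<le> 1 \<longrightarrow>
        (\<integral>t. \<bar>\<Sum>i<n. x i * f i t\<bar> \<partial>lebesgue_on {0..1}) \<le> C / \<theta>) \<and>
     (\<forall>\<theta> n x. 0 < \<theta> \<longrightarrow> 1 \<le> (\<Sum>i<n. M (\<theta> * x i)) \<longrightarrow>
        1 / (C * \<theta>) \<le> (\<integral>t. \<bar>\<Sum>i<n. x i * f i t\<bar> \<partial>lebesgue_on {0..1}))"

lemma models_orlicz_integrable:
  "models_orlicz M C f \<Longrightarrow> integrable (lebesgue_on {0..1}) (\<lambda>t. \<Sum>i<n. x i * f i t)"
  unfolding models_orlicz_def by blast

lemma models_orlicz_upper:
  "models_orlicz M C f \<Longrightarrow> 0 < \<theta> \<Longrightarrow> (\<Sum>i<n. M (\<theta> * x i)) \<le> 1 \<Longrightarrow>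
    (\<integral>t. \<bar>\<Sum>i<n. x i * f i t\<bar> \<partial>lebesgue_on {0..1}) \<le> C / \<theta>"
  unfolding models_orlicz_def by blast

lemma models_orlicz_lower:
  "models_orlicz M C f \<Longrightarrow> 0 < \<theta> \<Longrightarrow> 1 \<le> (\<Sum>i<n. M (\<theta> * x i)) \<Longrightarrow>
    1 / (C * \<theta>) \<le> (\<integral>t. \<bar>\<Sum>i<n. x i * f i t\<bar> \<partial>lebesgue_on {0..1})"
  unfolding models_orlicz_def by blast

text \<open>Both sides are homogeneous, so replacing \<open>x\<close> by
  \<open>\<theta> * x / b\<close> reduces every scale to the single scale \<open>b\<close>.\<close>

lemma models_orliczI:
  assumes int: "\<And>n x. integrable (lebesgue_on {0..1}) (\<lambda>t. \<Sum>i<n. x i * f i t)"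
    and upper: "\<And>n x. (\<Sum>i<n. M (b * x i)) \<le> 1 \<Longrightarrow>
      (\<integral>t. \<bar>\<Sum>i<n. x i * f i t\<bar> \<partial>lebesgue_on {0..1}) \<le> c"
    and lower: "\<And>n x. 1 \<le> (\<Sum>i<n. M (b * x i)) \<Longrightarrow>
      1 / d \<le> (\<integral>t. \<bar>\<Sum>i<n. x i * f i t\<bar> \<partial>lebesgue_on {0..1})"
    and "b > 0" "d > 0" "c * b \<le> C" "d / b \<le> C"
  shows "models_orlicz M C f"
  unfolding models_orlicz_def
proof (intro conjI allI impI)
  fix \<theta> :: real and n x assume \<theta>: "0 < \<theta>"
  let ?I = "\<integral>t. \<bar>\<Sum>i<n. x i * f i t\<bar> \<partial>lebesgue_on {0..1}"
  have "\<bar>\<Sum>i<n. \<theta> * x i / b * f i t\<bar> = \<theta> / b * \<bar>\<Sum>i<n. x i * f i t\<bar>" for t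
  proof -
    have "(\<Sum>i<n. \<theta> * x i / b * f i t) = \<theta> / b * (\<Sum>i<n. x i * f i t)"
      unfolding sum_distrib_left by (intro sum.cong) auto
    then show ?thesis using \<theta> \<open>b > 0\<close> by (simp only: abs_mult) simp
  qed
  then have scale: "(\<integral>t. \<bar>\<Sum>i<n. \<theta> * x i / b * f i t\<bar> \<partial>lebesgue_on {0..1}) = \<theta> / b * ?I"
    by simp
  have eq: "b * (\<theta> * x i / b) = \<theta> * x i" for i using \<open>b > 0\<close> by simp
  show "?I \<le> C / \<theta>" if "(\<Sum>i<n. M (\<theta> * x i)) \<le> 1"
  proof -
    have "\<theta> / b * ?I \<le> c"
      using upper[where n = n and x = "\<lambda>i. \<theta> * x i / b"] that unfolding eq scale by simp
    then have "?I \<le> c * b / \<theta>" using \<theta> \<open>b > 0\<close> by (simp add: field_simps)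
    also have "\<dots> \<le> C / \<theta>" using assms \<theta> by (intro divide_right_mono) auto
    finally show ?thesis .
  qed
  show "1 / (C * \<theta>) \<le> ?I" if "1 \<le> (\<Sum>i<n. M (\<theta> * x i))"
  proof -
    have "1 / d \<le> \<theta> / b * ?I"
      using lower[where n = n and x = "\<lambda>i. \<theta> * x i / b"] that unfolding eq scale by simp
    then have "1 / (d / b * \<theta>) \<le> ?I" using \<theta> \<open>b > 0\<close> \<open>d > 0\<close> by (simp add: field_simps)
    moreover have "0 < d / b" using \<open>b > 0\<close> \<open>d > 0\<close> by simp
    then have "0 < C" using \<open>d / b \<le> C\<close> by linarith
    have "1 / (C * \<theta>) \<le> 1 / (d / b * \<theta>)"
      using \<open>d / b \<le> C\<close> \<theta> \<open>0 < d / b\<close> \<open>0 < C\<close>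
      by (intro divide_left_mono mult_right_mono mult_pos_pos) auto
    ultimately show ?thesis by linarith
  qed
qed (rule int)

lemma (in growth_1_2) models_orlicz_exists:
  assumes "b > 0" and N: "\<And>t. N (b * t) = M t"
  shows "\<exists>f C. C \<ge> 1 \<and> models_orlicz N C f"
proof -
  \<comment> \<open>The errors add up to at most \<open>1 / 32\<close>, half of the
    \<open>1 / 16\<close> that a modular of 1 contributes.\<close>
  define \<epsilon> :: "nat \<Rightarrow> real" where "\<epsilon> i = (1 / 2) ^ i / 64" for i
  have \<epsilon>_sum: "(\<Sum>i<n. \<epsilon> i) \<le> 1 / 32" for n
  proof -
    have "(\<Sum>i<n. \<epsilon> i) = 1 / 32 - (1 / 2) ^ n / 32"
      by (induction n) (auto simp: \<epsilon>_def)
    then show ?thesis by simp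
  qed
  have \<epsilon>_nonneg: "0 \<le> \<epsilon> i" for i by (simp add: \<epsilon>_def)
  define law where "law i as \<longleftrightarrow> as \<noteq> [] \<and>
    (\<forall>u :: real \<Rightarrow> real. (\<forall>a. u (- a) = - u a) \<longrightarrow> (\<Sum>a\<leftarrow>as. u a) = 0) \<and>
    (\<forall>u :: real \<Rightarrow> real. (\<forall>a. - 1 \<le> u a) \<longrightarrow> u 0 = 1 \<longrightarrow> 0 \<le> (\<Sum>a\<leftarrow>as. u a)) \<and>
    (\<forall>t. \<bar>t\<bar> \<le> 1 \<longrightarrow> M t / 16 - \<epsilon> i \<le> (\<Sum>a\<leftarrow>as. quad_lin (t * a)) / real (length as)) \<and>
    (\<forall>t. \<bar>t\<bar> \<le> 1 \<longrightarrow> (\<Sum>a\<leftarrow>as. quad_lin (t * a)) / real (length as) \<le> 2 * M t + \<epsilon> i)"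
    for i and as :: "real list"
  have "\<exists>as. law i as" for i
  proof -
    have "0 < \<epsilon> i" by (simp add: \<epsilon>_def)
    then show ?thesis
      by (rule symmetric_law, intro exI) (unfold law_def, intro conjI allI impI; blast)
  qed
  then obtain as where as: "law i (as i)" for i by metis
  interpret symmetric_digits as
    using as by unfold_locales (auto simp: law_def)
  have avg_lower: "M t / 16 - \<epsilon> i \<le> avg i (\<lambda>a. quad_lin (t * a))"
    and avg_upper: "avg i (\<lambda>a. quad_lin (t * a)) \<le> 2 * M t + \<epsilon> i" if "\<bar>t\<bar> \<le> 1" for t i
    using as[of i] that unfolding law_def avg_def by blast+
  have rv_sum: "rv_sum n x = (\<lambda>t. \<Sum>i<n. x i * rv i t)" for n x
    by (simp add: rv_sum_def fun_eq_iff)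
  \<comment> \<open>The upper bound is \<open>1 / 2 + 2 + 1 / 32 \<le> 3\<close>. For the lower one,
    \<open>B \<ge> 1 / 32\<close> gives \<open>B / (1 + 2 * B) \<ge> 1 / 34\<close>, and 510 is
    \<open>15 * 34\<close>.\<close>
  have "models_orlicz N (max 1 (max (3 * b) (510 / b))) rv"
  proof (rule models_orliczI[of _ N b 3 510], unfold N)
    fix n x
    show "integrable (lebesgue_on {0..1}) (\<lambda>t. \<Sum>i<n. x i * rv i t)"
      using integrable_rv_sum[of n x] by (simp add: rv_sum)
  next
    fix n :: nat and x :: "nat \<Rightarrow> real" assume le: "(\<Sum>i<n. M (x i)) \<le> 1"
    have x: "\<bar>x i\<bar> \<le> 1" if "i < n" for i
    proof (rule M_le_1_imp)
      have "M (x i) \<le> (\<Sum>i<n. M (x i))"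
        using that by (intro member_le_sum M_nonneg) auto
      with le show "M (x i) \<le> 1" by simp
    qed
    have "(\<integral>t. \<bar>rv_sum n x t\<bar> \<partial>lebesgue_on {0..1}) \<le> 1 / 2 + (\<Sum>i<n. avg i (\<lambda>a. quad_lin (x i * a)))"
      by (rule integral_abs_rv_sum_le)
    also have "(\<Sum>i<n. avg i (\<lambda>a. quad_lin (x i * a))) \<le> (\<Sum>i<n. 2 * M (x i) + \<epsilon> i)"
      using avg_upper x by (intro sum_mono) auto
    also have "\<dots> = 2 * (\<Sum>i<n. M (x i)) + (\<Sum>i<n. \<epsilon> i)"
      by (simp add: sum.distrib sum_distrib_left)
    finally show "(\<integral>t. \<bar>\<Sum>i<n. x i * rv i t\<bar> \<partial>lebesgue_on {0..1}) \<le> 3"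
      using le \<epsilon>_sum[of n] by (simp add: rv_sum)
  next
    fix n :: nat and x :: "nat \<Rightarrow> real" assume ge: "1 \<le> (\<Sum>i<n. M (x i))"
    define B where "B = (\<Sum>i<n. avg i (\<lambda>a. quad_lin (x i * a)))"
    have avg_nonneg: "0 \<le> avg i (\<lambda>a. quad_lin (t * a))" for i t
      using avg_mono[of i "\<lambda>_. 0"] by (simp add: avg_const)
    have "1 / 32 \<le> B"
    proof (cases "\<forall>i<n. \<bar>x i\<bar> \<le> 1")
      case True
      have "(\<Sum>i<n. M (x i)) / 16 - (\<Sum>i<n. \<epsilon> i) \<le> B"
        unfolding B_def sum_divide_distrib sum_subtractf[symmetric]
        using True avg_lower by (intro sum_mono) auto
      then show ?thesis using ge \<epsilon>_sum[of n] by simp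
    next
      case False
      \<comment> \<open>The laws imitate \<open>M\<close> only up to 1, but one coefficient beyond 1
        is enough: by monotonicity its term is at least the value at 1.\<close>
      then obtain i where i: "i < n" "1 < \<bar>x i\<bar>" by auto
      have "1 / 16 - \<epsilon> i \<le> avg i (\<lambda>a. quad_lin (1 * a))"
        using avg_lower[of 1 i] M_1 by simp
      also have "\<dots> \<le> avg i (\<lambda>a. quad_lin (x i * a))"
        using i(2) by (intro avg_mono quad_lin_mono) (auto simp: abs_mult mult_le_cancel_right1)
      also have "\<dots> \<le> B"
        unfolding B_def using i(1) avg_nonneg
        by (intro member_le_sum[where f = "\<lambda>i. avg i (\<lambda>a. quad_lin (x i * a))"]) auto
      finally have "1 / 16 - \<epsilon> i \<le> B" .
      moreover have "\<epsilon> i \<le> 1 / 32"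
        using \<epsilon>_sum[of "Suc i"] sum_nonneg[of "{..<i}" \<epsilon>] \<epsilon>_nonneg by simp
      ultimately show ?thesis by simp
    qed
    then have "1 / 34 \<le> B / (1 + 2 * B)"
      by (simp add: field_simps)
    also have "\<dots> \<le> 15 * (\<integral>t. \<bar>rv_sum n x t\<bar> \<partial>lebesgue_on {0..1})"
      unfolding B_def by (rule integral_abs_rv_sum_ge)
    finally show "1 / 510 \<le> (\<integral>t. \<bar>\<Sum>i<n. x i * rv i t\<bar> \<partial>lebesgue_on {0..1})"
      by (simp add: rv_sum)
  qed (use assms in auto)
  then show ?thesis by (intro exI[of _ rv] exI[of _ "max 1 (max (3 * b) (510 / b))"]) auto
qed

text \<open>By convexity \<open>M s \<ge> s * M 1\<close> for \<open>s \<ge> 1\<close>, so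
  \<open>M\<close> reaches 1, and convex functions are continuous.\<close>

lemma orlicz_function_eq_1:
  assumes "orlicz_function M"
  obtains b where "b > 0" "M b = 1"
proof -
  have M: "convex_on UNIV M" "M 0 = 0" "M 1 > 0"
    using assms by (auto simp: orlicz_function_def)
  define s where "s = max 1 (1 / M 1)"
  have s: "1 \<le> s" "1 / M 1 \<le> s" by (auto simp: s_def)
  have "M (1 / s * s) \<le> 1 / s * M s"
    using s by (intro orlicz_function_growth_upper assms) auto
  then have "s * M 1 \<le> M s" using s by (simp add: field_simps)
  moreover have "1 \<le> s * M 1" using s M by (simp add: field_simps)
  ultimately have "1 \<le> M s" by linarith
  moreover have "continuous_on {0..s} M"
    using convex_on_continuous[OF open_UNIV M(1)] by (rule continuous_on_subset) simp
  ultimately obtain b where "0 \<le> b" "b \<le> s" "M b = 1"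
    using IVT'[of M 0 1 s] M s by auto
  moreover from this have "b \<noteq> 0" using M by auto
  ultimately show thesis by (intro that[of b]) auto
qed

lemma orlicz_model:
  assumes M: "orlicz_function M" "two_concave M"
  obtains f C where "C \<ge> 1" "models_orlicz M C f"
proof -
  obtain b where b: "b > 0" "M b = 1" using orlicz_function_eq_1[OF M(1)] .
  interpret growth_1_2 "\<lambda>t. M (b * t)"
  proof
    show "k\<^sup>2 * M (b * t) \<le> M (b * (k * t))" "M (b * (k * t)) \<le> k * M (b * t)" if "0 \<le> k" "k \<le> 1" for k t
      using two_concave_growth_lower[OF M that, of "b * t"]
        orlicz_function_growth_upper[OF M(1) that, of "b * t"] by (simp_all add: mult_ac)
  qed (use M b in \<open>auto simp: orlicz_function_def\<close>)
  show thesis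
    using models_orlicz_exists[of b M] b that by auto
qed

section \<open>The operator as a limit of partial sums, and its two norm bounds\<close>

theorem corollary3:
  fixes M :: "real \<Rightarrow> real"
  assumes "orlicz_function M"
    and "two_concave M"
  shows "\<exists>(T :: (nat \<Rightarrow> real) \<Rightarrow> (real \<Rightarrow> real)) (C :: real).
           C \<ge> 1 \<and> linear_into_L1 (orlicz_space M) T \<and>
           (\<forall>x\<in>orlicz_space M.
              inverse C * orlicz_norm M x \<le> L1_norm (T x) \<and>
              L1_norm (T x) \<le> C * orlicz_norm M x)"
proof -
  let ?L = "lebesgue_on {0..1::real}"
  obtain f C where C: "C \<ge> 1" and f: "models_orlicz M C f"
    using orlicz_model[OF assms] .
  note int = models_orlicz_integrable[OF f]
    and upper = models_orlicz_upper[OF f]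
    and lower = models_orlicz_lower[OF f]
  define S where "S x n t = (\<Sum>i<n. x i * f i t)" for x n t
  have int_S: "integrable ?L (S x n)" for x n
    unfolding S_def[abs_def] by (rule int)
  have M_nonneg: "0 \<le> M t" for t using assms(1) by (rule orlicz_function_nonneg)
  have M_0: "M 0 = 0" using assms(1) by (simp add: orlicz_function_def)
  \<comment> \<open>2-concavity bounds \<open>M (\<theta> * x i)\<close> by a multiple of
    \<open>M (\<theta>0 * x i)\<close>, so the modular series converges at every scale. Tails thus
    have modular below 1 for arbitrarily large \<open>\<theta>\<close>, and their integrals are at
    most \<open>C / \<theta>\<close>.\<close>
  have limit_exists: "\<exists>g. L1_limit ?L (S x) g" if x: "x \<in> orlicz_space M" for x
  proof -
    define \<theta>0 where "\<theta>0 = 1 / (orlicz_norm M x + 1)"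
    have norm: "0 \<le> orlicz_norm M x" using orlicz_space_enorm(2)[OF assms(1) x] .
    then have \<theta>0: "\<theta>0 > 0" "orlicz_norm M x < 1 / \<theta>0" by (auto simp: \<theta>0_def)
    have summable: "summable (\<lambda>i. M (\<theta>0 * x i))"
      using sum_le_1_of_orlicz_norm[OF assms(1) x \<theta>0] M_nonneg
      by (intro summableI_nonneg_bounded[where x = 1]) auto
    have "\<exists>N. \<forall>i\<ge>N. \<forall>j\<ge>N. (\<integral>t. norm (S x i t - S x j t) \<partial>?L) < e" if "e > 0" for e
    proof -
      define \<theta> where "\<theta> = max \<theta>0 (2 * C / e)"
      have \<theta>: "\<theta> > 0" "\<theta>0 \<le> \<theta>" using \<theta>0 by (auto simp: \<theta>_def)
      have "2 * C / e \<le> \<theta>" by (simp add: \<theta>_def)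
      then have "C / \<theta> < e" using \<open>e > 0\<close> C \<theta>(1) by (simp add: field_simps)
      have "M (\<theta> * x i) \<le> (\<theta> / \<theta>0)\<^sup>2 * M (\<theta>0 * x i)" for i
      proof -
        have "(\<theta>0 / \<theta>)\<^sup>2 * M (\<theta> * x i) \<le> M (\<theta>0 / \<theta> * (\<theta> * x i))"
          using \<theta> \<theta>0 by (intro two_concave_growth_lower assms) auto
        then show ?thesis using \<theta> \<theta>0 by (simp add: field_simps)
      qed
      then have "summable (\<lambda>i. M (\<theta> * x i))"
        using M_nonneg summable
        by (intro summable_comparison_test'[OF summable_mult[OF summable]]) auto
      then obtain N where N: "\<And>m n. m \<ge> N \<Longrightarrow> norm (\<Sum>i=m..<n. M (\<theta> * x i)) < 1"
        unfolding summable_Cauchy by (meson zero_less_one)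
      have less: "(\<integral>t. \<bar>S x j t - S x i t\<bar> \<partial>?L) < e" if "N \<le> i" "i \<le> j" for i j
      proof -
        \<comment> \<open>Zeroing the first \<open>i\<close> coordinates presents a block of the
          series as an initial sum, to which \<open>upper\<close> applies.\<close>
        define z where "z l = (if l < i then 0 else x l)" for l
        have split: "(\<Sum>l<j. g l) = (\<Sum>l<i. g l) + (\<Sum>l=i..<j. g l)" for g :: "nat \<Rightarrow> real"
          using sum.atLeastLessThan_concat[of 0 i j g] \<open>i \<le> j\<close> by (simp add: atLeast0LessThan)
        have "S x j t - S x i t = (\<Sum>l<j. z l * f l t)" for t
          by (simp add: S_def split z_def)
        moreover have "(\<Sum>l<j. M (\<theta> * z l)) \<le> 1"
          using N[OF \<open>N \<le> i\<close>, of j] by (simp add: split z_def M_0)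
        ultimately show ?thesis
          using upper[OF \<theta>(1), of z j] \<open>C / \<theta> < e\<close> by simp
      qed
      have "(\<integral>t. norm (S x i t - S x j t) \<partial>?L) < e" if "i \<ge> N" "j \<ge> N" for i j
        using less[of i j] less[of j i] that by (cases "i \<le> j") (auto simp: abs_minus_commute)
      then show ?thesis by blast
    qed
    then obtain g where "integrable ?L g" "(\<lambda>n. \<integral>t. norm (S x n t - g t) \<partial>?L) \<longlonglongrightarrow> 0"
      using L1_complete[of ?L "S x", OF int_S] by blast
    then show ?thesis using int_S by (auto simp: L1_limit_def)
  qed
  define T where "T x = (SOME g. L1_limit ?L (S x) g)" for x
  \<comment> \<open>Stated for every \<open>x\<close> with a limit, so that sums and multiples are
    covered by exhibiting their limits.\<close>
  have T: "L1_limit ?L (S x) (T x)" if "L1_limit ?L (S x) g" for x g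
    unfolding T_def by (rule someI[where P = "L1_limit ?L (S x)", OF that])
  have T_space: "L1_limit ?L (S x) (T x)" if "x \<in> orlicz_space M" for x
    using limit_exists[OF that] T by blast
  have "linear_into_L1 (orlicz_space M) T"
    unfolding linear_into_L1_def
  proof (intro conjI ballI allI)
    fix x assume x: "x \<in> orlicz_space M"
    show "T x \<in> L1"
      using T_space[OF x] by (simp add: L1_def L1_limit_def)
    show "L1_eq (T (\<lambda>i. c * x i)) (\<lambda>t. c * T x t)" for c
    proof -
      have "S (\<lambda>i. c * x i) = (\<lambda>n t. c * S x n t)"
        by (simp add: S_def fun_eq_iff sum_distrib_left mult.assoc)
      then have "L1_limit ?L (S (\<lambda>i. c * x i)) (\<lambda>t. c * T x t)"
        using L1_limit_cmult[OF T_space[OF x]] by simp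
      then show ?thesis
        unfolding L1_eq_def using L1_limit_unique T by blast
    qed
    fix y assume y: "y \<in> orlicz_space M"
    have "S (\<lambda>i. x i + y i) = (\<lambda>n t. S x n t + S y n t)"
      by (simp add: S_def fun_eq_iff sum.distrib distrib_right)
    then have "L1_limit ?L (S (\<lambda>i. x i + y i)) (\<lambda>t. T x t + T y t)"
      using L1_limit_add[OF T_space[OF x] T_space[OF y]] by simp
    then show "L1_eq (T (\<lambda>i. x i + y i)) (\<lambda>t. T x t + T y t)"
      unfolding L1_eq_def using L1_limit_unique T by blast
  qed
  moreover have "inverse (2 * C) * orlicz_norm M x \<le> L1_norm (T x) \<and> L1_norm (T x) \<le> 2 * C * orlicz_norm M x"
    if x: "x \<in> orlicz_space M" for x
  proof -
    have norm: "0 \<le> orlicz_norm M x" using orlicz_space_enorm(2)[OF assms(1) x] .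
    have lim: "(\<lambda>n. \<integral>t. \<bar>\<Sum>i<n. x i * f i t\<bar> \<partial>?L) \<longlonglongrightarrow> L1_norm (T x)"
      using L1_limit_norm[OF T_space[OF x]] by (simp add: L1_norm_def S_def)
    \<comment> \<open>Approaching the norm strictly from above provides the strict inequality that
      \<open>sum_le_1_of_orlicz_norm\<close> requires, with \<open>\<theta> = 1 / a\<close>.\<close>
    have "L1_norm (T x) / C \<le> orlicz_norm M x"
    proof (rule dense_ge)
      fix a assume a: "orlicz_norm M x < a"
      then have "a > 0" using norm by simp
      have "(\<integral>t. \<bar>\<Sum>i<n. x i * f i t\<bar> \<partial>?L) \<le> C / (1 / a)" for n
        using a \<open>a > 0\<close> by (intro upper sum_le_1_of_orlicz_norm[OF assms(1) x]) auto
      then have "L1_norm (T x) \<le> C * a"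
        by (intro LIMSEQ_le_const2[OF lim]) auto
      then show "L1_norm (T x) / C \<le> a" using C by (simp add: field_simps)
    qed
    then have "L1_norm (T x) \<le> C * orlicz_norm M x" using C by (simp add: field_simps)
    also have "\<dots> \<le> 2 * C * orlicz_norm M x" using C norm by simp
    finally have le: "L1_norm (T x) \<le> 2 * C * orlicz_norm M x" .
    have "orlicz_norm M x / 2 \<le> C * L1_norm (T x)"
    proof (rule dense_ge)
      fix a assume a: "C * L1_norm (T x) < a"
      moreover have "0 \<le> C * L1_norm (T x)" using C by (simp add: L1_norm_def)
      ultimately have "a > 0" by linarith
      \<comment> \<open>A partial modular above 1 stays above 1 for all longer sums, so
        \<open>lower\<close> survives in the limit and contradicts the choice of \<open>a\<close>.
        The factor 2 in the final constant comes from \<open>orlicz_norm_le\<close>.\<close>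
      have "(\<Sum>i<n. M (1 / a * x i)) \<le> 1" for n
      proof (rule ccontr)
        assume gt: "\<not> ?thesis"
        have "1 / (C * (1 / a)) \<le> (\<integral>t. \<bar>\<Sum>i<m. x i * f i t\<bar> \<partial>?L)" if "m \<ge> n" for m
        proof (rule lower)
          have "(\<Sum>i<n. M (1 / a * x i)) \<le> (\<Sum>i<m. M (1 / a * x i))"
            using that M_nonneg by (intro sum_mono2) auto
          with gt show "1 \<le> (\<Sum>i<m. M (1 / a * x i))" by linarith
        qed (use \<open>a > 0\<close> in simp)
        then have "1 / (C * (1 / a)) \<le> L1_norm (T x)"
          by (intro LIMSEQ_le_const[OF lim]) auto
        with a show False using C by (simp add: field_simps)
      qed
      then have "orlicz_norm M x \<le> 2 / (1 / a)"
        using \<open>a > 0\<close> by (intro orlicz_norm_le assms x) auto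
      then show "orlicz_norm M x / 2 \<le> a" by simp
    qed
    then have "inverse (2 * C) * orlicz_norm M x \<le> L1_norm (T x)"
      using C by (simp add: field_simps)
    with le show ?thesis by simp
  qed
  ultimately show ?thesis
    using C by (intro exI[of _ T] exI[of _ "2 * C"]) auto
qed

end
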